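(* There exist absolute constants $c,C\ge 1$ and an online scheduler $\texttt{ALG}$ for the serial-parallel scheduling problem that is allowed to use cancelling, such that for every task arrival process $\mathcal{T}$, $$\mathrm{TRT}_{\texttt{ALG}}^{\mathcal{T}}\le C\cdot \mathrm{TRT}_{\texttt{OPT}}^{c\cdot\mathcal{T}};$$ that is, with $O(1)$ speed augmentation and cancelling, $\texttt{ALG}$ is $O(1)$-competitive for mean response time.
   Context: Serial-parallel scheduling problem: $p$ identical processors ($p$ at least a sufficiently large constant). A task arrival process (TAP) is a finite set of tasks $\tau_i=(\sigma_i,\pi_i,t_i)$, $i=1,\dots,n$, with arrival time $t_i\ge0$, serial work $\sigma_i$ and parallel work $\pi_i$, $1\le\pi_i/\sigma_i\le p$. A task is performed either by its serial job (work $\sigma_i$, at most one processor at any instant) or by its parallel job (work $\pi_i$, any number of processors, rate equal to number of processors). Time is continuous; processors are allocated (fractionally via time sharing) among arrived unfinished jobs; a job completes when the integral of its allocated processors reaches its work. Before starting a task the scheduler irrevocably chooses an implementation; preemption is allowed. A scheduler with cancelling may additionally stop a running task, erasing all its progress, and restart it with the other implementation. An online scheduler learns about a task only at its arrival. The total response time $\mathrm{TRT}^{\mathcal{T}}_{\texttt{ALG}}=\sum_i(f_i-t_i)$, where $f_i$ is the completion time of $\tau_i$; mean response time is $\mathrm{TRT}/n$. $\mathrm{TRT}^{\mathcal{T}}_{\texttt{OPT}}$ is the minimum total response time achievable by an offline (non-cancelling) schedule on $\mathcal{T}$. For $c>0$, $c\cdot\mathcal{T}$ is $\mathcal{T}$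 with all serial and parallel works multiplied by $c$ (equivalently, $\texttt{ALG}$ runs on processors $c$ times faster than $\texttt{OPT}$'s). *)

theory Defs
  imports "HOL-Analysis.Analysis"
begin

text \<open>A task is a triple (serial work, parallel work, arrival time).
  A task arrival process (TAP) is a finite list of tasks, listed in order of
  arrival time (any finite set of tasks can be so listed).\<close>

type_synonym task = "real \<times> real \<times> real"

definition sw :: "task \<Rightarrow> real" where "sw \<tau> = fst \<tau>"
definition pw :: "task \<Rightarrow> real" where "pw \<tau> = fst (snd \<tau>)"
definition arr :: "task \<Rightarrow> real" where "arr \<tau> = snd (snd \<tau>)"

definition work :: "task \<Rightarrow> bool \<Rightarrow> real" where
  "work \<tau> b = (if b then pw \<tau> else sw \<tau>)"

definition tap :: "nat \<Rightarrow> task list \<Rightarrow> bool" where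
  "tap p T \<longleftrightarrow> sorted (map arr T) \<and>
     (\<forall>\<tau>\<in>set T. arr \<tau> \<ge> 0 \<and> sw \<tau> > 0 \<and> sw \<tau> \<le> pw \<tau> \<and> pw \<tau> \<le> real p * sw \<tau>)"

definition scale_tap :: "real \<Rightarrow> task list \<Rightarrow> task list" where
  "scale_tap c T = map (\<lambda>(s, q, a). (c * s, c * q, a)) T"

text \<open>A (possibly cancelling) schedule, tasks indexed by position in the TAP:
  alloc i t = number of processors (fractional) given to task i at time t;
  impl0 i = implementation initially chosen for task i (True = parallel);
  cancels i = the finite set of times at which task i is cancelled and restarted
    with the other implementation (progress erased);
  fin i = completion time of task i.\<close>
record sched =
  alloc :: "nat \<Rightarrow> real \<Rightarrow> real"
  impl0 :: "nat \<Rightarrow> bool"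
  cancels :: "nat \<Rightarrow> real set"
  fin :: "nat \<Rightarrow> real"

text \<open>Implementation of task i in force on the time interval ending at t
  (cancels strictly before t have taken effect).\<close>
definition mode :: "sched \<Rightarrow> nat \<Rightarrow> real \<Rightarrow> bool" where
  "mode S i t = (if even (card {s \<in> cancels S i. s < t}) then impl0 S i else \<not> impl0 S i)"

definition last_start :: "task list \<Rightarrow> sched \<Rightarrow> nat \<Rightarrow> real \<Rightarrow> real" where
  "last_start T S i t = Max ({arr (T ! i)} \<union> {s \<in> cancels S i. s < t})"

definition progress :: "task list \<Rightarrow> sched \<Rightarrow> nat \<Rightarrow> real \<Rightarrow> real" where
  "progress T S i t = integral {last_start T S i t .. t} (alloc S i)"

definition valid_sched :: "nat \<Rightarrow> task list \<Rightarrow> sched \<Rightarrow> bool" where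
  "valid_sched p T S \<longleftrightarrow>
     (\<forall>t. (\<Sum>i<length T. alloc S i t) \<le> real p) \<and>
     (\<forall>i<length T.
        (\<forall>t. alloc S i t \<ge> 0) \<and>
        (\<forall>t. t < arr (T ! i) \<or> fin S i \<le> t \<longrightarrow> alloc S i t = 0) \<and>
        (\<forall>a b. alloc S i integrable_on {a..b}) \<and>
        (\<forall>t. \<not> mode S i t \<longrightarrow> alloc S i t \<le> 1) \<and>
        finite (cancels S i) \<and>
        (\<forall>s\<in>cancels S i. arr (T ! i) < s \<and> s < fin S i) \<and>
        arr (T ! i) < fin S i \<and>
        (\<forall>t. arr (T ! i) < t \<and> t < fin S i \<longrightarrow>
              progress T S i t < work (T ! i) (mode S i t)) \<and>
        progress T S i (fin S i) = work (T ! i) (mode S i (fin S i)))"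

definition TRT :: "task list \<Rightarrow> sched \<Rightarrow> real" where
  "TRT T S = (\<Sum>i<length T. fin S i - arr (T ! i))"

definition TRT_OPT :: "nat \<Rightarrow> task list \<Rightarrow> real" where
  "TRT_OPT p T = Inf {TRT T S | S. valid_sched p T S \<and> (\<forall>i<length T. cancels S i = {})}"

definition online_cancelling_scheduler :: "nat \<Rightarrow> (task list \<Rightarrow> sched) \<Rightarrow> bool" where
  "online_cancelling_scheduler p ALG \<longleftrightarrow>
     (\<forall>T. tap p T \<longrightarrow> valid_sched p T (ALG T)) \<and>
     (\<forall>T T' k t. tap p T \<longrightarrow> tap p T' \<longrightarrow> take k T = take k T' \<longrightarrow>
        (\<forall>\<tau>\<in>set (drop k T). t < arr \<tau>) \<longrightarrow> (\<forall>\<tau>\<in>set (drop k T'). t < arr \<tau>) \<longrightarrow>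
        (\<forall>i<length (take k T).
           (\<forall>s\<le>t. alloc (ALG T) i s = alloc (ALG T') i s) \<and>
           {s \<in> cancels (ALG T) i. s \<le> t} = {s \<in> cancels (ALG T') i. s \<le> t} \<and>
           (arr (T ! i) \<le> t \<longrightarrow> impl0 (ALG T) i = impl0 (ALG T') i)))"

end

theory Submission
  imports Defs
begin

text \<open>
  Consider a virtual equal-sharing schedule in which every live task runs its serial job at rate
  \<open>min 1 (p/2N)\<close> and simultaneously its parallel job at rate \<open>p/4N\<close>, where \<open>N\<close> is the number of live
  tasks, and leaves as soon as one of the two is finished. The real schedule executes the serial
  jobs exactly in this way on half of the processors. When the virtual parallel job of a task
  finishes first, the task is cancelled and its parallel job is run for real on the other half,
  with priority to tasks of small virtual response time. Since the real rate is twice the virtual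
  one, a busy-period argument shows that this at most doubles every response time.

  The virtual schedule does not have to know which implementation the optimum chooses. If
  \<open>rank\<^sub>i\<close> is the number of live tasks that arrived no later than \<open>i\<close>, then the sum of
  \<open>rank\<^sub>i / N\<close> over the live tasks is at least \<open>N/2\<close>, and the rank of a task never increases. Hence the
  total virtual response time is at most twice the sum over \<open>i\<close> of the integral of \<open>rank\<^sub>i / N\<close>; the
  part before the optimum finishes \<open>i\<close> is paid for by the optimum, and the part after it is charged to
  the work of the optimum on \<open>i\<close>, which is \<open>c\<close> times larger than that of the virtual schedule.
\<close>

subsection \<open>Causal first-hitting systems and integrals\<close>

text \<open>All completion times solve systems of the form: \<open>v i\<close> is the first time \<open>t \<ge> a i\<close> at which
  \<open>D i v t\<close> holds, where \<open>D i v t\<close> inspects \<open>v\<close> only before time \<open>t\<close>. Later completions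
  only slow the others down, so Knaster--Tarski gives a solution, without simulating events;
  causality makes it unique up to any given time, which is what the online property asks for.\<close>

definition hits :: "'i set \<Rightarrow> ('i \<Rightarrow> real) \<Rightarrow> ('i \<Rightarrow> ('i \<Rightarrow> real) \<Rightarrow> real \<Rightarrow> bool) \<Rightarrow> ('i \<Rightarrow> real) \<Rightarrow> bool" where
  "hits I a D v \<longleftrightarrow> (\<forall>i\<in>I. a i \<le> v i \<and> D i v (v i) \<and> (\<forall>t. a i \<le> t \<and> t < v i \<longrightarrow> \<not> D i v t))"

lemma hits_subset: "hits I a D v \<Longrightarrow> J \<subseteq> I \<Longrightarrow> hits J a D v"
  unfolding hits_def by blast

text \<open>\<open>top\<close> keeps every set of candidate times nonempty, \<open>clo\<close> makes
  its infimum attained, and \<open>anti\<close> makes the first hit monotone in the vector of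
  completion times. Knaster-Tarski then applies on the box between \<open>a\<close> and
  \<open>B\<close>.\<close>

lemma hits_exists:
  fixes a B :: "'i \<Rightarrow> real"
  assumes aB: "\<And>i. i \<in> I \<Longrightarrow> a i \<le> B i"
    and top: "\<And>i v. i \<in> I \<Longrightarrow> D i v (B i)"
    and anti: "\<And>i v w t. i \<in> I \<Longrightarrow> (\<And>j. j \<in> I \<Longrightarrow> w j \<le> v j) \<Longrightarrow> a i \<le> t \<Longrightarrow> D i v t \<Longrightarrow> D i w t"
    and clo: "\<And>i v. i \<in> I \<Longrightarrow> closed {t \<in> {a i..B i}. D i v t}"
  shows "\<exists>v. hits I a D v \<and> (\<forall>i\<in>I. v i \<le> B i)"
proof -
  define K where "K v i = {t \<in> {a i..B i}. D i v t}" for v i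
  define G where "G v i = Inf (K v i)" for v i
  have ne: "K v i \<noteq> {}" if "i \<in> I" for v i
    using aB[OF that] top[OF that] by (auto simp: K_def)
  have bdd: "bdd_below (K v i)" for v i
    by (auto simp: K_def bdd_below_def)
  have GK: "G v i \<in> K v i" if "i \<in> I" for v i
    unfolding G_def using closed_contains_Inf[OF ne[OF that] bdd] clo[OF that] by (simp add: K_def)
  have Gmono: "G w i \<le> G v i" if "i \<in> I" "\<And>j. j \<in> I \<Longrightarrow> w j \<le> v j" for v w i
    unfolding G_def
  proof (rule cInf_superset_mono[OF ne[OF that(1)] bdd])
    show "K v i \<subseteq> K w i" using anti[OF that(1) that(2)] by (auto simp: K_def)
  qed
  \<comment> \<open>The pre-fixed points of \<open>G\<close> in the box; their pointwise infimum
    \<open>v\<close> is the least fixed point. \<open>B\<close> itself belongs to \<open>X\<close>,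
    so the infimum is over a nonempty set.\<close>
  define X where "X = {w. \<forall>i\<in>I. a i \<le> w i \<and> w i \<le> B i \<and> G w i \<le> w i}"
  define v where "v i = Inf ((\<lambda>w. w i) ` X)" for i
  have BX: "B \<in> X" using GK aB by (auto simp: X_def K_def)
  have vle: "v i \<le> w i" if "w \<in> X" "i \<in> I" for w i
    unfolding v_def by (rule cInf_lower) (use that in \<open>auto simp: X_def bdd_below_def\<close>)
  have Gv: "G v i \<le> v i" if "i \<in> I" for i
    unfolding v_def[of i]
  proof (rule cInf_greatest)
    show "(\<lambda>w. w i) ` X \<noteq> {}" using BX by auto
    fix x assume "x \<in> (\<lambda>w. w i) ` X"
    then obtain w where w: "w \<in> X" "x = w i" by auto
    have "G v i \<le> G w i" by (rule Gmono[OF that vle[OF w(1)]])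
    then show "G v i \<le> x" using w that by (auto simp: X_def)
  qed
  have "G v \<in> X" using GK Gmono[of _ "G v" v] Gv by (auto simp: X_def K_def)
  then have eq: "v i = G v i" if "i \<in> I" for i using vle[of "G v" i] Gv[of i] that by auto
  have "a i \<le> v i \<and> D i v (v i) \<and> v i \<le> B i" if "i \<in> I" for i
    using GK[of i v] that by (simp add: K_def eq[OF that, symmetric])
  moreover have "\<not> D i v t" if i: "i \<in> I" and t: "a i \<le> t" "t < v i" for i t
  proof
    assume "D i v t"
    then have "t \<in> K v i" using t calculation[OF i] by (auto simp: K_def)
    then have "G v i \<le> t" unfolding G_def by (rule cInf_lower[OF _ bdd])
    then show False using t eq[OF i] by simp
  qed
  ultimately show ?thesis unfolding hits_def by blast
qed

text \<open>At the earliest moment \<open>m\<close> of a disagreement, both solutions still look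
  alike when truncated at \<open>m\<close>. So the two conditions have the same truth value there,
  and the solution that hits at \<open>m\<close> forces the other one to hit as well. The truncation
  \<open>min (v j) u\<close> is what an observer at time \<open>u\<close> knows of
  \<open>v j\<close>.\<close>

lemma hits_causal:
  assumes fin: "finite I" and a: "\<And>i. i \<in> I \<Longrightarrow> a i = a' i"
    and v: "hits I a D v" and v': "hits I a' D' v'"
    and causal: "\<And>i u. i \<in> I \<Longrightarrow> u \<le> t \<Longrightarrow> (\<And>j. j \<in> I \<Longrightarrow> min (v j) u = min (v' j) u) \<Longrightarrow> D i v u \<longleftrightarrow> D' i v' u"
    and i: "i \<in> I" "v i \<le> t \<or> v' i \<le> t"
  shows "v i = v' i"
proof (rule ccontr)
  assume ne: "v i \<noteq> v' i"
  define V where "V = {i \<in> I. (v i \<le> t \<or> v' i \<le> t) \<and> v i \<noteq> v' i}"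
  have "finite V" "V \<noteq> {}" using fin i ne by (auto simp: V_def)
  then obtain k where k: "k \<in> V" and kmin: "\<And>j. j \<in> V \<Longrightarrow> min (v k) (v' k) \<le> min (v j) (v' j)"
    using ex_is_arg_min_if_finite[of V "\<lambda>j. min (v j) (v' j)"]
    by (auto simp: is_arg_min_linorder)
  define m where "m = min (v k) (v' k)"
  have mt: "m \<le> t" and kI: "k \<in> I" and kne: "v k \<noteq> v' k" using k by (auto simp: V_def m_def)
  \<comment> \<open>Indices in \<open>V\<close> have both times at least \<open>m\<close> by
    minimality; any other index has equal times or both times beyond \<open>t\<close>.\<close>
  have "min (v j) m = min (v' j) m" if "j \<in> I" for j
  proof (cases "j \<in> V")
    case True
    then show ?thesis using kmin[OF True] by (auto simp: m_def[symmetric])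
  next
    case False
    then show ?thesis using that mt by (auto simp: V_def)
  qed
  then have D: "D k v m \<longleftrightarrow> D' k v' m" using causal[OF kI mt] by blast
  have "a k \<le> v k" "a k \<le> v' k" "D k v (v k)" "D' k v' (v' k)"
    "\<And>t. a k \<le> t \<Longrightarrow> t < v k \<Longrightarrow> \<not> D k v t" "\<And>t. a k \<le> t \<Longrightarrow> t < v' k \<Longrightarrow> \<not> D' k v' t"
    using v v' kI a[OF kI] by (auto simp: hits_def)
  then show False using D kne unfolding m_def by (metis linorder_neqE_linordered_idom min.strict_order_iff min.commute)
qed

section \<open>Integrals of rates: integrability, first hits and clipping\<close>

lemma integral_cong_halfopen:
  fixes f g :: "real \<Rightarrow> real"
  assumes "\<And>s. a \<le> s \<Longrightarrow> s < b \<Longrightarrow> f s = g s"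
  shows "integral {a..b} f = integral {a..b} g"
  by (rule integral_spike[of "{b}"]) (use assms in auto)

lemma bounded_borel_integrable:
  fixes f :: "real \<Rightarrow> real"
  assumes "f \<in> borel_measurable borel" and "\<And>x. \<bar>f x\<bar> \<le> K"
  shows "f integrable_on {a..b}"
proof (rule measurable_bounded_by_integrable_imp_integrable)
  show "f \<in> borel_measurable (lebesgue_on {a..b})"
    using assms(1) by (simp add: borel_measurable_if_I measurable_completion measurable_restrict_space1)
  show "(\<lambda>_. K) integrable_on {a..b}" by (rule integrable_const_ivl)
qed (use assms in auto)

lemma closed_integral_ge:
  fixes f :: "real \<Rightarrow> real"
  assumes "\<And>a b. f integrable_on {a..b}"
  shows "closed {t \<in> {a..b}. w \<le> r * integral {a..t} f}"
proof -
  have "continuous_on {a..b} (\<lambda>t. r * integral {a..t} f)"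
    by (intro continuous_intros indefinite_integral_continuous_1 assms)
  then show ?thesis using continuous_closed_preimage[OF _ _ closed_atLeast[of w], of "{a..b}"]
    by (auto simp: vimage_def Int_def)
qed

text \<open>Work grows continuously in time, so it cannot overshoot its target at the first
  hit.\<close>

lemma integral_first_hit:
  fixes f :: "real \<Rightarrow> real"
  assumes int: "\<And>a b. f integrable_on {a..b}" and ab: "a < b"
    and lt: "\<And>t. a \<le> t \<Longrightarrow> t < b \<Longrightarrow> r * integral {a..t} f < w"
  shows "r * integral {a..b} f \<le> w"
proof -
  have "continuous_on {a..b} (\<lambda>t. r * integral {a..t} f)"
    by (intro continuous_intros indefinite_integral_continuous_1 int)
  then have "((\<lambda>t. r * integral {a..t} f) \<longlongrightarrow> r * integral {a..b} f) (at b within {a..b})"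
    using ab by (auto simp: continuous_on)
  then have "((\<lambda>t. r * integral {a..t} f) \<longlongrightarrow> r * integral {a..b} f) (at_left b)"
    using ab by (simp add: at_within_Icc_at_left)
  moreover have "eventually (\<lambda>t. r * integral {a..t} f \<le> w) (at_left b)"
    using eventually_at_left_real[OF ab] by eventually_elim (simp add: lt less_imp_le)
  ultimately show ?thesis
    using tendsto_upperbound trivial_limit_at_left_real by blast
qed

lemma integral_superset_mono:
  fixes f :: "real \<Rightarrow> real"
  assumes "\<And>a b. f integrable_on {a..b}" "\<And>x. 0 \<le> f x" "c \<le> a" "b \<le> d"
  shows "integral {a..b} f \<le> integral {c..d} f"
  by (rule integral_subset_le) (use assms in auto)

lemma clip_integrable:
  fixes h :: "real \<Rightarrow> real"
  assumes "\<And>a b. h integrable_on {a..b}"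
  shows "(\<lambda>s. if s \<in> {a..b} then h s else 0) integrable_on {c..d}"
  unfolding integrable_restrict_Int Int_atLeastAtMost by (rule assms)

lemma integral_clip_le:
  fixes h :: "real \<Rightarrow> real"
  assumes int: "\<And>a b. h integrable_on {a..b}" and nonneg: "\<And>x. 0 \<le> h x"
  shows "integral {c..d} (\<lambda>s. if s \<in> {a..b} then h s else 0) \<le> integral {a..b} h"
proof -
  have "integral {c..d} (\<lambda>s. if s \<in> {a..b} then h s else 0) = integral ({a..b} \<inter> {c..d}) h"
    by (rule integral_restrict_Int)
  also have "\<dots> \<le> integral {a..b} h"
    by (rule integral_subset_le) (use int nonneg in \<open>auto simp: Int_atLeastAtMost\<close>)
  finally show ?thesis .
qed

subsection \<open>The virtual schedule\<close>

definition live :: "real \<Rightarrow> real \<Rightarrow> real \<Rightarrow> real" where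
  "live a b s = (if a \<le> s \<and> s < b then 1 else 0)"

text \<open>The maximum with 1 keeps the rates antitone in the load: division by an empty load would
  give rate 0.\<close>

definition load :: "task list \<Rightarrow> (nat \<Rightarrow> real) \<Rightarrow> real \<Rightarrow> real" where
  "load T v s = max 1 (\<Sum>j<length T. live (arr (T ! j)) (v j) s)"

definition srate :: "nat \<Rightarrow> task list \<Rightarrow> (nat \<Rightarrow> real) \<Rightarrow> real \<Rightarrow> real" where
  "srate p T v s = min 1 (real p / (2 * load T v s))"

definition prate :: "nat \<Rightarrow> task list \<Rightarrow> (nat \<Rightarrow> real) \<Rightarrow> real \<Rightarrow> real" where
  "prate p T v s = real p / (4 * load T v s)"

definition vdone :: "nat \<Rightarrow> task list \<Rightarrow> nat \<Rightarrow> (nat \<Rightarrow> real) \<Rightarrow> real \<Rightarrow> bool" where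
  "vdone p T i v t \<longleftrightarrow> sw (T ! i) \<le> integral {arr (T ! i)..t} (srate p T v) \<or>
     pw (T ! i) \<le> integral {arr (T ! i)..t} (prate p T v)"

definition virtual :: "nat \<Rightarrow> task list \<Rightarrow> (nat \<Rightarrow> real) \<Rightarrow> bool" where
  "virtual p T v \<longleftrightarrow> hits {..<length T} (\<lambda>i. arr (T ! i)) (vdone p T) v"

lemma live_bounds: "0 \<le> live a b s" "live a b s \<le> 1"
  by (auto simp: live_def)

lemma live_measurable [measurable]: "live a b \<in> borel_measurable borel"
  unfolding live_def by measurable

lemma integral_live:
  fixes h :: "real \<Rightarrow> real"
  assumes "c \<le> a" "b \<le> d"
  shows "integral {c..d} (\<lambda>s. live a b s * h s) = integral {a..b} h"
proof -
  have "integral {c..d} (\<lambda>s. live a b s * h s) = integral {c..d} (\<lambda>s. if s \<in> {a..b} then h s else 0)"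
    by (rule integral_spike[of "{b}"]) (auto simp: live_def)
  also have "\<dots> = integral {a..b} h"
    unfolding integral_restrict_Int using assms by (simp add: Int_atLeastAtMost)
  finally show ?thesis .
qed

lemma live_mult_integrable:
  assumes "\<And>a b. h integrable_on {a..b}"
  shows "(\<lambda>s. live a b s * h s) integrable_on {c..d}"
proof (rule integrable_spike[of "\<lambda>s. if s \<in> {a..b} then h s else 0" _ "{b}"])
  show "(\<lambda>s. if s \<in> {a..b} then h s else 0) integrable_on {c..d}"
    by (rule clip_integrable[OF assms])
qed (auto simp: live_def)

lemma load_measurable [measurable]: "load T v \<in> borel_measurable borel"
  unfolding load_def by measurable

lemma load_ge_1: "1 \<le> load T v s"
  by (simp add: load_def)

lemma load_le: "load T v s \<le> 1 + real (length T)"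
  using sum_bounded_above[of "{..<length T}" "\<lambda>j. live (arr (T ! j)) (v j) s" 1]
  by (simp add: load_def live_bounds)

lemma load_mono:
  assumes "\<And>j. j < length T \<Longrightarrow> w j \<le> v j"
  shows "load T w s \<le> load T v s"
  unfolding load_def by (intro max.mono sum_mono order_refl) (use assms in \<open>force simp: live_def\<close>)

lemma sum_live_le_load: "(\<Sum>j<length T. live (arr (T ! j)) (v j) s) \<le> load T v s"
  by (simp add: load_def)

lemma load_eq:
  assumes "i < length T" "arr (T ! i) \<le> s" "s < v i"
  shows "load T v s = (\<Sum>j<length T. live (arr (T ! j)) (v j) s)"
proof -
  have "live (arr (T ! i)) (v i) s \<le> (\<Sum>j<length T. live (arr (T ! j)) (v j) s)"
    by (rule member_le_sum) (use assms live_bounds in auto)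
  then show ?thesis using assms by (simp add: load_def live_def)
qed

lemma srate_bounds: "0 \<le> srate p T v s" "srate p T v s \<le> 1"
  using load_ge_1[of T v s] by (auto simp: srate_def)

lemma prate_bounds: "0 \<le> prate p T v s" "prate p T v s \<le> real p"
  using load_ge_1[of T v s] mult_left_mono[of 1 "4 * load T v s" "real p"]
  by (auto simp: prate_def divide_le_eq)

lemma srate_integrable: "srate p T v integrable_on {a..b}"
proof (rule bounded_borel_integrable)
  show "srate p T v \<in> borel_measurable borel" unfolding srate_def by measurable
  show "\<bar>srate p T v x\<bar> \<le> 1" for x using srate_bounds[of p T v x] by simp
qed

lemma prate_integrable: "prate p T v integrable_on {a..b}"
proof (rule bounded_borel_integrable)
  show "prate p T v \<in> borel_measurable borel" unfolding prate_def by measurable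
  show "\<bar>prate p T v x\<bar> \<le> real p" for x using prate_bounds[of p T v x] by simp
qed

lemma srate_anti:
  assumes "\<And>j. j < length T \<Longrightarrow> w j \<le> v j"
  shows "srate p T v s \<le> srate p T w s"
  unfolding srate_def using load_mono[of T w v s] load_ge_1[of T w s] load_ge_1[of T v s] assms
  by (intro min.mono order_refl divide_left_mono) (auto intro!: mult_pos_pos)

lemma prate_anti:
  assumes "\<And>j. j < length T \<Longrightarrow> w j \<le> v j"
  shows "prate p T v s \<le> prate p T w s"
  unfolding prate_def using load_mono[of T w v s] load_ge_1[of T w s] load_ge_1[of T v s] assms
  by (intro divide_left_mono) (auto intro!: mult_pos_pos)

lemma sum_live_srate_le: "(\<Sum>j<length T. live (arr (T ! j)) (v j) s * srate p T v s) \<le> real p / 2"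
proof -
  have "(\<Sum>j<length T. live (arr (T ! j)) (v j) s * srate p T v s) \<le> load T v s * srate p T v s"
    unfolding sum_distrib_right[symmetric] by (intro mult_right_mono sum_live_le_load srate_bounds)
  also have "\<dots> \<le> load T v s * (real p / (2 * load T v s))"
    using load_ge_1[of T v s] by (intro mult_left_mono) (auto simp: srate_def)
  also have "\<dots> = real p / 2" using load_ge_1[of T v s] by simp
  finally show ?thesis .
qed

text \<open>A quarter of the processors bounds the virtual parallel work per unit of time, while the
  real queue serves at rate \<open>p / 2\<close>. This factor of two drives the busy-period
  argument.\<close>

lemma sum_live_prate_le: "(\<Sum>j<length T. live (arr (T ! j)) (v j) s * prate p T v s) \<le> real p / 4"
proof -
  have "(\<Sum>j<length T. live (arr (T ! j)) (v j) s * prate p T v s) \<le> load T v s * prate p T v s"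
    unfolding sum_distrib_right[symmetric] by (intro mult_right_mono sum_live_le_load prate_bounds)
  also have "\<dots> = real p / 4" using load_ge_1[of T v s] by (simp add: prate_def)
  finally show ?thesis .
qed

lemma tap_nth:
  assumes "tap p T" "i < length T"
  shows "0 \<le> arr (T ! i)" "0 < sw (T ! i)" "0 < pw (T ! i)"
proof -
  have "T ! i \<in> set T" using assms(2) by simp
  then have "0 \<le> arr (T ! i) \<and> 0 < sw (T ! i) \<and> sw (T ! i) \<le> pw (T ! i)"
    using assms(1) unfolding tap_def by blast
  then show "0 \<le> arr (T ! i)" "0 < sw (T ! i)" "0 < pw (T ! i)" by auto
qed

lemma virtual_exists:
  assumes "tap p T" "1 \<le> p"
  shows "\<exists>v. virtual p T v"
proof -
  \<comment> \<open>A lower bound on the serial rate that holds for every \<open>v\<close>, as the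
    load is at most \<open>1 + length T\<close>. Hence every serial job is finished by time
    \<open>B i\<close> at the latest, which is the a priori bound required by
    \<open>hits_exists\<close>.\<close>
  define \<kappa> where "\<kappa> = min 1 (real p / (2 * (1 + real (length T))))"
  have \<kappa>: "\<kappa> > 0" using assms(2) by (simp add: \<kappa>_def)
  have sr: "\<kappa> \<le> srate p T v s" for v s
    unfolding \<kappa>_def srate_def using load_le[of T v s] load_ge_1[of T v s]
    by (intro min.mono order_refl divide_left_mono) (auto intro!: mult_pos_pos)
  define B where "B i = arr (T ! i) + sw (T ! i) / \<kappa>" for i
  have pos: "sw (T ! i) > 0" if "i < length T" for i
    using assms(1) that by (auto simp: tap_def)
  have "\<exists>v. hits {..<length T} (\<lambda>i. arr (T ! i)) (vdone p T) v \<and> (\<forall>i\<in>{..<length T}. v i \<le> B i)"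
  proof (rule hits_exists)
    fix i v assume i: "i \<in> {..<length T}"
    show le: "arr (T ! i) \<le> B i" using pos[of i] \<kappa> i by (simp add: B_def)
    have "sw (T ! i) = integral {arr (T ! i)..B i} (\<lambda>_. \<kappa>)" using le \<kappa> by (simp add: B_def)
    also have "\<dots> \<le> integral {arr (T ! i)..B i} (srate p T v)"
      by (rule integral_le) (use sr srate_integrable in auto)
    finally show "vdone p T i v (B i)" by (simp add: vdone_def)
    show "closed {t \<in> {arr (T ! i)..B i}. vdone p T i v t}"
      using closed_Un[OF closed_integral_ge[where f = "srate p T v" and r = 1, OF srate_integrable]
          closed_integral_ge[where f = "prate p T v" and r = 1, OF prate_integrable],
          of "arr (T ! i)" "B i" "sw (T ! i)" "arr (T ! i)" "B i" "pw (T ! i)"]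
      by (simp add: vdone_def Un_def conj_disj_distribL)
  next
    fix i v w t
    assume "i \<in> {..<length T}" and wv: "\<And>j. j \<in> {..<length T} \<Longrightarrow> w j \<le> v j"
      and "vdone p T i v t"
    moreover have "integral {arr (T ! i)..t} (srate p T v) \<le> integral {arr (T ! i)..t} (srate p T w)"
      by (rule integral_le) (use wv srate_anti srate_integrable in auto)
    moreover have "integral {arr (T ! i)..t} (prate p T v) \<le> integral {arr (T ! i)..t} (prate p T w)"
      by (rule integral_le) (use wv prate_anti prate_integrable in auto)
    ultimately show "vdone p T i w t" by (auto simp: vdone_def)
  qed
  then show ?thesis by (auto simp: virtual_def)
qed

lemma virtual_props:
  assumes "tap p T" "virtual p T v" "i < length T"
  shows "arr (T ! i) < v i"
    and "\<And>t. t < v i \<Longrightarrow> integral {arr (T ! i)..t} (srate p T v) < sw (T ! i)"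
    and "integral {arr (T ! i)..v i} (srate p T v) \<le> sw (T ! i)"
    and "integral {arr (T ! i)..v i} (prate p T v) \<le> pw (T ! i)"
    and "integral {arr (T ! i)..v i} (srate p T v) < sw (T ! i) \<Longrightarrow>
      integral {arr (T ! i)..v i} (prate p T v) = pw (T ! i)"
proof -
  have pos: "sw (T ! i) > 0" "pw (T ! i) > 0" using tap_nth[OF assms(1,3)] by auto
  have h: "arr (T ! i) \<le> v i" "vdone p T i v (v i)"
    "\<And>t. arr (T ! i) \<le> t \<Longrightarrow> t < v i \<Longrightarrow> \<not> vdone p T i v t"
    using assms(2,3) by (auto simp: virtual_def hits_def)
  show lt: "arr (T ! i) < v i"
    using h(1,2) pos by (cases "arr (T ! i) = v i") (auto simp: vdone_def)
  show "integral {arr (T ! i)..t} (srate p T v) < sw (T ! i)" if "t < v i" for t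
    using h(3)[of t] that pos by (cases "arr (T ! i) \<le> t") (auto simp: vdone_def)
  show "integral {arr (T ! i)..v i} (srate p T v) \<le> sw (T ! i)"
    using integral_first_hit[OF srate_integrable lt, of 1] h(3) by (force simp: vdone_def)
  show par: "integral {arr (T ! i)..v i} (prate p T v) \<le> pw (T ! i)"
    using integral_first_hit[OF prate_integrable lt, of 1] h(3) by (force simp: vdone_def)
  show "integral {arr (T ! i)..v i} (prate p T v) = pw (T ! i)"
    if "integral {arr (T ! i)..v i} (srate p T v) < sw (T ! i)"
    using that par h(2) by (auto simp: vdone_def)
qed

section \<open>Causality of the virtual schedule\<close>

definition agree :: "real \<Rightarrow> nat \<Rightarrow> task list \<Rightarrow> task list \<Rightarrow> bool" where
  "agree t m T T' \<longleftrightarrow> m \<le> length T \<and> m \<le> length T' \<and> (\<forall>i<m. T ! i = T' ! i) \<and>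
     (\<forall>i. m \<le> i \<and> i < length T \<longrightarrow> t < arr (T ! i)) \<and>
     (\<forall>i. m \<le> i \<and> i < length T' \<longrightarrow> t < arr (T' ! i))"

text \<open>Tasks from index \<open>m\<close> on arrive after \<open>t\<close>, so they contribute
  nothing to a load at a time up to \<open>t\<close>.\<close>

lemma load_agree:
  assumes ag: "agree t m T T'" and s: "s \<le> t" and v: "\<And>j. j < m \<Longrightarrow> s < v j \<longleftrightarrow> s < v' j"
  shows "load T v s = load T' v' s"
proof -
  have cut: "(\<Sum>j<length U. live (arr (U ! j)) (w j) s) = (\<Sum>j<m. live (arr (U ! j)) (w j) s)"
    if "m \<le> length U" "\<And>i. m \<le> i \<Longrightarrow> i < length U \<Longrightarrow> t < arr (U ! i)" for U w
  proof (rule sum.mono_neutral_right)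
    show "\<forall>i\<in>{..<length U} - {..<m}. live (arr (U ! i)) (w i) s = 0"
    proof
      fix i assume "i \<in> {..<length U} - {..<m}"
      then have "t < arr (U ! i)" using that(2) by simp
      then show "live (arr (U ! i)) (w i) s = 0" using s by (simp add: live_def)
    qed
  qed (use that(1) in auto)
  have "(\<Sum>j<m. live (arr (T ! j)) (v j) s) = (\<Sum>j<m. live (arr (T' ! j)) (v' j) s)"
    by (rule sum.cong) (use ag v in \<open>auto simp: agree_def live_def\<close>)
  then show ?thesis using cut[of T v] cut[of T' v'] ag by (auto simp: load_def agree_def)
qed

lemma rate_agree:
  assumes "agree t m T T'" "s \<le> t" "\<And>j. j < m \<Longrightarrow> s < v j \<longleftrightarrow> s < v' j"
  shows "srate p T v s = srate p T' v' s" "prate p T v s = prate p T' v' s"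
  using load_agree[OF assms] by (auto simp: srate_def prate_def)

lemma virtual_agree:
  assumes ag: "agree t m T T'" and v: "virtual p T v" "virtual p T' v'"
    and i: "i < m" "v i \<le> t \<or> v' i \<le> t"
  shows "v i = v' i"
proof (rule hits_causal[where I = "{..<m}" and a = "\<lambda>i. arr (T ! i)" and a' = "\<lambda>i. arr (T' ! i)"])
  show "hits {..<m} (\<lambda>i. arr (T ! i)) (vdone p T) v"
    by (rule hits_subset[OF v(1)[unfolded virtual_def]]) (use ag in \<open>auto simp: agree_def\<close>)
  show "hits {..<m} (\<lambda>i. arr (T' ! i)) (vdone p T') v'"
    by (rule hits_subset[OF v(2)[unfolded virtual_def]]) (use ag in \<open>auto simp: agree_def\<close>)
  fix i u assume i: "i \<in> {..<m}" and u: "u \<le> t"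
    and mins: "\<And>j. j \<in> {..<m} \<Longrightarrow> min (v j) u = min (v' j) u"
  \<comment> \<open>Equal truncations at \<open>u\<close> mean the same live tasks at every time
    before \<open>u\<close>, hence the same rates there.\<close>
  have iff: "s < v j \<longleftrightarrow> s < v' j" if "s < u" "j < m" for s j
    using mins[of j] that by (auto simp: min_def split: if_splits)
  have "integral {arr (T ! i)..u} (srate p T v) = integral {arr (T ! i)..u} (srate p T' v')"
    "integral {arr (T ! i)..u} (prate p T v) = integral {arr (T ! i)..u} (prate p T' v')"
    by (intro integral_cong_halfopen rate_agree[OF ag]; use iff u in auto)+
  then show "vdone p T i v u \<longleftrightarrow> vdone p T' i v' u"
    using i ag by (simp add: vdone_def agree_def)
qed (use ag i in \<open>auto simp: agree_def\<close>)

subsection \<open>The queue of cancelled tasks\<close>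

text \<open>The tasks to be cancelled: the serial job is still unfinished at \<open>v i\<close>, so
  the virtual parallel job has ended first. A tie counts as a serial completion.\<close>

definition late :: "nat \<Rightarrow> task list \<Rightarrow> (nat \<Rightarrow> real) \<Rightarrow> nat \<Rightarrow> bool" where
  "late p T v i \<longleftrightarrow> integral {arr (T ! i)..v i} (srate p T v) < sw (T ! i)"

text \<open>Shortest virtual response time first, with ties broken by index to obtain a strict total
  order. A task joins the queue at time \<open>v i\<close>, when its key is already known, so the
  order can be used online.\<close>

definition prior :: "task list \<Rightarrow> (nat \<Rightarrow> real) \<Rightarrow> nat \<Rightarrow> nat \<Rightarrow> bool" where
  "prior T v j i \<longleftrightarrow> v j - arr (T ! j) < v i - arr (T ! i) \<or>
     (v j - arr (T ! j) = v i - arr (T ! i) \<and> j < i)"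

definition blocked :: "nat \<Rightarrow> task list \<Rightarrow> (nat \<Rightarrow> real) \<Rightarrow> (nat \<Rightarrow> real) \<Rightarrow> nat \<Rightarrow> real \<Rightarrow> bool" where
  "blocked p T v f i s \<longleftrightarrow> (\<exists>j<length T. late p T v j \<and> prior T v j i \<and> v j \<le> s \<and> s < f j)"

definition free :: "nat \<Rightarrow> task list \<Rightarrow> (nat \<Rightarrow> real) \<Rightarrow> (nat \<Rightarrow> real) \<Rightarrow> nat \<Rightarrow> real \<Rightarrow> real" where
  "free p T v f i s = (if blocked p T v f i s then 0 else 1)"

definition qdone :: "nat \<Rightarrow> task list \<Rightarrow> (nat \<Rightarrow> real) \<Rightarrow> nat \<Rightarrow> (nat \<Rightarrow> real) \<Rightarrow> real \<Rightarrow> bool" where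
  "qdone p T v i f t \<longleftrightarrow> pw (T ! i) \<le> real p / 2 * integral {v i..t} (free p T v f i)"

definition queue :: "nat \<Rightarrow> task list \<Rightarrow> (nat \<Rightarrow> real) \<Rightarrow> (nat \<Rightarrow> real) \<Rightarrow> bool" where
  "queue p T v f \<longleftrightarrow> hits {i. i < length T \<and> late p T v i} v (qdone p T v) f"

lemma free_bounds: "0 \<le> free p T v f i s" "free p T v f i s \<le> 1"
  by (auto simp: free_def)

lemma free_measurable [measurable]: "free p T v f i \<in> borel_measurable borel"
  unfolding free_def blocked_def by measurable

lemma free_integrable: "free p T v f i integrable_on {a..b}"
proof (rule bounded_borel_integrable[OF free_measurable])
  show "\<bar>free p T v f i x\<bar> \<le> 1" for x by (auto simp: free_def)
qed

lemma prior_trans: "prior T v i j \<Longrightarrow> prior T v j k \<Longrightarrow> prior T v i k"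
  by (auto simp: prior_def)

lemma prior_asym: "prior T v i j \<Longrightarrow> \<not> prior T v j i"
  by (auto simp: prior_def)

lemma prior_total: "i \<noteq> j \<Longrightarrow> prior T v i j \<or> prior T v j i"
  by (auto simp: prior_def)

text \<open>Busy-period argument: work served between the start \<open>s0\<close> of the busy period and \<open>f i\<close> comes
  from tasks with virtual response time at most \<open>L\<close>, so it was virtually executed inside
  \<open>{s0 - L..f i}\<close>, at half of the real rate.\<close>

lemma queue_deadline:
  assumes tap: "tap p T" and p: "1 \<le> p" and vir: "virtual p T v"
    and i: "i < length T" "late p T v i"
    and start: "\<And>k. k < length T \<Longrightarrow> late p T v k \<Longrightarrow> v k \<le> f k"
    and served: "\<And>k. k < length T \<Longrightarrow> late p T v k \<Longrightarrow>
      real p / 2 * integral {v k..f k} (free p T v f k) \<le> pw (T ! k)"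
    and overdue: "v i + (v i - arr (T ! i)) \<le> f i"
  shows "qdone p T v i f (f i)"
proof (rule ccontr)
  assume nd: "\<not> qdone p T v i f (f i)"
  define L where "L = v i - arr (T ! i)"
  have L: "0 < L" "v i + L \<le> f i" using virtual_props(1)[OF tap vir i(1)] overdue by (auto simp: L_def)
  define H where "H = {k. k < length T \<and> late p T v k \<and> (k = i \<or> prior T v k i)}"
  have finH: "finite H" and iH: "i \<in> H" using i by (auto simp: H_def)
  \<comment> \<open>From \<open>u\<close> until \<open>f i\<close>, some job of \<open>H\<close>
    (priority at least that of \<open>i\<close>) is always pending.\<close>
  define cov where "cov u \<longleftrightarrow> (\<forall>s. u \<le> s \<and> s < f i \<longrightarrow> (\<exists>k\<in>H. v k \<le> s \<and> s < f k))" for u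
  define X where "X = {u \<in> v ` H. cov u \<and> u \<le> v i}"
  have "cov (v i)" unfolding cov_def using iH by blast
  then have "v i \<in> X" "finite X" using iH finH by (auto simp: X_def)
  define s0 where "s0 = Min X"
  have s0X: "s0 \<in> X" unfolding s0_def by (rule Min_in) (use \<open>v i \<in> X\<close> \<open>finite X\<close> in auto)
  then have s0: "cov s0" "s0 \<le> v i" by (auto simp: X_def)
  define W where "W = {k \<in> H. s0 \<le> v k \<and> v k \<le> f i}"
  have finW: "finite W" and iW: "i \<in> W" and WH: "W \<subseteq> H" using finH iH s0 L by (auto simp: W_def)
  \<comment> \<open>At each moment of the busy period the pending job of highest priority is
    unblocked, and it entered the queue within the period.\<close>
  have serve: "1 \<le> (\<Sum>k\<in>W. if s \<in> {v k..f k} then free p T v f k s else 0)" if s: "s \<in> {s0..<f i}" for s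
  proof -
    define Z where "Z = {k \<in> H. v k \<le> s \<and> s < f k}"
    have "finite Z" "Z \<noteq> {}" using finH s0(1) s by (auto simp: Z_def cov_def)
    then obtain k where k: "k \<in> Z" and kmin: "\<And>j. j \<in> Z \<Longrightarrow> j \<noteq> k \<Longrightarrow> \<not> prior T v j k"
      using Finite_Set.bex_min_element[of Z "prior T v"] prior_asym prior_trans
      unfolding asymp_on_def transp_on_def by metis
    have nb: "\<not> blocked p T v f k s"
    proof
      assume "blocked p T v f k s"
      then obtain j where j: "j < length T" "late p T v j" "prior T v j k" "v j \<le> s" "s < f j"
        unfolding blocked_def by blast
      then have "j \<in> Z" using k prior_trans unfolding Z_def H_def by blast
      moreover have "j \<noteq> k" using j(3) prior_asym by blast
      ultimately show False using kmin j(3) by blast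
    qed
    \<comment> \<open>Otherwise the pending interval of \<open>k\<close> would extend the busy
      period to the left of \<open>s0\<close>.\<close>
    have "s0 \<le> v k"
    proof (rule ccontr)
      assume c: "\<not> s0 \<le> v k"
      have "cov (v k)" unfolding cov_def
      proof (intro allI impI)
        fix u assume u: "v k \<le> u \<and> u < f i"
        show "\<exists>k\<in>H. v k \<le> u \<and> u < f k"
        proof (cases "u < s0")
          case True
          then show ?thesis using k u s by (intro bexI[of _ k]) (auto simp: Z_def)
        next
          case False
          then show ?thesis using s0(1) u by (auto simp: cov_def)
        qed
      qed
      then have "v k \<in> X" using k c s0(2) by (auto simp: X_def Z_def)
      then have "s0 \<le> v k" unfolding s0_def using \<open>finite X\<close> by (rule Min_le[rotated])
      then show False using c by simp
    qed
    then have kW: "k \<in> W" using k s by (auto simp: W_def Z_def)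
    have "1 = (if s \<in> {v k..f k} then free p T v f k s else 0)"
      using k nb by (auto simp: Z_def free_def)
    also have "\<dots> \<le> (\<Sum>k\<in>W. if s \<in> {v k..f k} then free p T v f k s else 0)"
      by (rule member_le_sum[OF kW]) (use finW free_bounds in auto)
    finally show ?thesis .
  qed
  have clip: "(\<lambda>s. if s \<in> {v k..f k} then free p T v f k s else 0) integrable_on {c..d}" for k c d
    by (rule clip_integrable[OF free_integrable])
  have "f i - s0 = integral {s0..f i} (\<lambda>_. 1)" using s0 L by simp
  \<comment> \<open>The integrand is patched at \<open>f i\<close>, because \<open>serve\<close>
    covers only times strictly before it.\<close>
  also have "\<dots> \<le> integral {s0..f i} (\<lambda>s. if s = f i then 1 else (\<Sum>k\<in>W. if s \<in> {v k..f k} then free p T v f k s else 0))"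
  proof (rule integral_le)
    show "(\<lambda>s. if s = f i then 1 else (\<Sum>k\<in>W. if s \<in> {v k..f k} then free p T v f k s else 0)) integrable_on {s0..f i}"
      by (rule integrable_spike[where S = "{f i}", OF integrable_sum[OF finW clip]]) auto
  qed (use serve in auto)
  also have "\<dots> = integral {s0..f i} (\<lambda>s. \<Sum>k\<in>W. if s \<in> {v k..f k} then free p T v f k s else 0)"
    by (rule integral_cong_halfopen) auto
  also have "\<dots> = (\<Sum>k\<in>W. integral {s0..f i} (\<lambda>s. if s \<in> {v k..f k} then free p T v f k s else 0))"
    by (rule integral_sum[OF finW clip])
  also have "\<dots> \<le> (\<Sum>k\<in>W. integral {v k..f k} (free p T v f k))"
    by (intro sum_mono integral_clip_le free_integrable free_bounds)
  finally have "real p / 2 * (f i - s0) \<le> real p / 2 * (\<Sum>k\<in>W. integral {v k..f k} (free p T v f k))"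
    by (rule mult_left_mono) simp
  also have "\<dots> = (\<Sum>k\<in>W. real p / 2 * integral {v k..f k} (free p T v f k))"
    by (simp add: sum_distrib_left)
  \<comment> \<open>No job receives more than its work, and \<open>i\<close> has by assumption
    received strictly less.\<close>
  also have "\<dots> < (\<Sum>k\<in>W. pw (T ! k))"
    by (rule sum_strict_mono_ex1[OF finW])
      (use served WH nd iW in \<open>auto simp: H_def qdone_def not_le\<close>)
  \<comment> \<open>A late task has executed exactly its parallel work virtually during its life
    span, which has length at most \<open>L\<close> and ends at \<open>v k\<close>, within the
    window.\<close>
  also have "\<dots> = (\<Sum>k\<in>W. integral {s0 - L..f i} (\<lambda>s. live (arr (T ! k)) (v k) s * prate p T v s))"
  proof (rule sum.cong)
    fix k assume k: "k \<in> W"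
    then have kT: "k < length T" "late p T v k" and Lk: "v k - arr (T ! k) \<le> L"
      using WH by (auto simp: H_def prior_def L_def)
    have "pw (T ! k) = integral {arr (T ! k)..v k} (prate p T v)"
      using virtual_props(5)[OF tap vir kT(1)] kT(2) by (simp add: late_def)
    also have "\<dots> = integral {s0 - L..f i} (\<lambda>s. live (arr (T ! k)) (v k) s * prate p T v s)"
      by (rule integral_live[symmetric]) (use k Lk in \<open>auto simp: W_def\<close>)
    finally show "pw (T ! k) = integral {s0 - L..f i} (\<lambda>s. live (arr (T ! k)) (v k) s * prate p T v s)" .
  qed simp
  also have "\<dots> = integral {s0 - L..f i} (\<lambda>s. \<Sum>k\<in>W. live (arr (T ! k)) (v k) s * prate p T v s)"
    by (rule integral_sum[symmetric, OF finW live_mult_integrable[OF prate_integrable]])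
  also have "\<dots> \<le> integral {s0 - L..f i} (\<lambda>_. real p / 4)"
  proof (rule integral_le)
    show "(\<lambda>s. \<Sum>k\<in>W. live (arr (T ! k)) (v k) s * prate p T v s) integrable_on {s0 - L..f i}"
      by (rule integrable_sum[OF finW live_mult_integrable[OF prate_integrable]])
    fix s
    have "(\<Sum>k\<in>W. live (arr (T ! k)) (v k) s * prate p T v s) \<le>
        (\<Sum>k<length T. live (arr (T ! k)) (v k) s * prate p T v s)"
      by (rule sum_mono2) (use WH in \<open>auto simp: H_def live_bounds prate_bounds\<close>)
    then show "(\<Sum>k\<in>W. live (arr (T ! k)) (v k) s * prate p T v s) \<le> real p / 4"
      using sum_live_prate_le order_trans by blast
  qed (rule integrable_const_ivl)
  also have "\<dots> = real p / 4 * (f i - s0 + L)" using s0 L by simp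
  finally have "real p * (2 * (f i - s0)) < real p * (f i - s0 + L)" by (simp add: field_simps)
  \<comment> \<open>This forces \<open>f i - s0 < L\<close>, whereas \<open>s0 \<le> v i\<close> and
    \<open>v i + L \<le> f i\<close> give the opposite.\<close>
  then have "2 * (f i - s0) < f i - s0 + L" using p by simp
  then show False using s0 L by simp
qed

lemma queue_exists:
  assumes tap: "tap p T" and p: "1 \<le> p" and vir: "virtual p T v"
  shows "\<exists>f. queue p T v f \<and>
    (\<forall>i<length T. late p T v i \<longrightarrow> f i \<le> v i + (v i - arr (T ! i)))"
proof -
  define I where "I = {i. i < length T \<and> late p T v i}"
  define B where "B i = v i + (v i - arr (T ! i))" for i
  \<comment> \<open>A forced exit at the deadline \<open>B i\<close> supplies the a priori bound for
    \<open>hits_exists\<close>. Afterwards \<open>queue_deadline\<close> shows that a job that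
    reaches its deadline is done at that moment, so the solution also satisfies the system without
    forced exits.\<close>
  define D where "D i f t \<longleftrightarrow> qdone p T v i f t \<or> B i \<le> t" for i f t
  have vB: "v i < B i" if "i \<in> I" for i
    using virtual_props(1)[OF tap vir, of i] that by (simp add: I_def B_def)
  have "\<exists>f. hits I v D f \<and> (\<forall>i\<in>I. f i \<le> B i)"
  proof (rule hits_exists)
    fix i f assume i: "i \<in> I"
    show "v i \<le> B i" using vB[OF i] by simp
    show "D i f (B i)" by (simp add: D_def)
    have "{t \<in> {v i..B i}. D i f t} = {t \<in> {v i..B i}. qdone p T v i f t} \<union> {B i}"
      using vB[OF i] by (auto simp: D_def)
    then show "closed {t \<in> {v i..B i}. D i f t}"
      using closed_integral_ge[where f = "free p T v f i", OF free_integrable] by (simp add: qdone_def closed_Un)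
  next
    fix i f g t assume i: "i \<in> I" and gf: "\<And>j. j \<in> I \<Longrightarrow> g j \<le> f j" and D: "D i f t"
    have "free p T v f i s \<le> free p T v g i s" for s
      using gf by (force simp: free_def blocked_def I_def)
    then have "integral {v i..t} (free p T v f i) \<le> integral {v i..t} (free p T v g i)"
      by (intro integral_le free_integrable)
    then have "real p / 2 * integral {v i..t} (free p T v f i) \<le> real p / 2 * integral {v i..t} (free p T v g i)"
      by (rule mult_left_mono) simp
    then show "D i g t" using D by (auto simp: D_def qdone_def)
  qed
  then obtain f where f: "hits I v D f" and fB: "\<And>i. i \<in> I \<Longrightarrow> f i \<le> B i" by blast
  have pos: "pw (T ! i) > 0" if "i \<in> I" for i using tap_nth[OF tap] that by (simp add: I_def)
  have lt: "v i < f i" if i: "i \<in> I" for i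
  proof -
    have "\<not> D i f (v i)" using vB[OF i] pos[OF i] by (simp add: D_def qdone_def)
    then show ?thesis using f i unfolding hits_def by (metis less_eq_real_def)
  qed
  have served: "real p / 2 * integral {v i..f i} (free p T v f i) \<le> pw (T ! i)" if i: "i \<in> I" for i
    by (rule integral_first_hit[OF free_integrable lt[OF i]])
      (use f i in \<open>auto simp: hits_def D_def qdone_def not_le\<close>)
  have "qdone p T v i f (f i)" if i: "i \<in> I" for i
  proof (cases "B i \<le> f i")
    case True
    show ?thesis
      by (rule queue_deadline[OF tap p vir])
        (use i True lt served in \<open>auto simp: I_def B_def less_imp_le\<close>)
  next
    case False
    then show ?thesis using f i by (auto simp: hits_def D_def)
  qed
  then have "hits I v (qdone p T v) f" using f by (auto simp: hits_def D_def)
  then show ?thesis using fB unfolding queue_def I_def B_def by blast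
qed

lemma queue_props:
  assumes tap: "tap p T" and q: "queue p T v f" and i: "i < length T" "late p T v i"
  shows "v i < f i"
    and "\<And>t. t < f i \<Longrightarrow> real p / 2 * integral {v i..t} (free p T v f i) < pw (T ! i)"
    and "real p / 2 * integral {v i..f i} (free p T v f i) = pw (T ! i)"
proof -
  have h: "v i \<le> f i" "qdone p T v i f (f i)" "\<And>t. v i \<le> t \<Longrightarrow> t < f i \<Longrightarrow> \<not> qdone p T v i f t"
    using q i by (auto simp: queue_def hits_def)
  have pos: "0 < pw (T ! i)" using tap_nth[OF tap i(1)] by simp
  show lt: "v i < f i" using h(1,2) pos by (cases "v i = f i") (auto simp: qdone_def)
  show *: "real p / 2 * integral {v i..t} (free p T v f i) < pw (T ! i)" if "t < f i" for t
    using h(3)[of t] that pos by (cases "v i \<le> t") (auto simp: qdone_def)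
  have "real p / 2 * integral {v i..f i} (free p T v f i) \<le> pw (T ! i)"
    by (rule integral_first_hit[OF free_integrable lt *])
  then show "real p / 2 * integral {v i..f i} (free p T v f i) = pw (T ! i)"
    using h(2) by (simp add: qdone_def)
qed

section \<open>Causality of the queue\<close>

lemma agree_sym: "agree t m T T' \<Longrightarrow> agree t m T' T"
  unfolding agree_def by metis

text \<open>Completion times indistinguishable to an observer at time \<open>t\<close>: values
  beyond \<open>t\<close> may differ.\<close>

definition vagree :: "real \<Rightarrow> nat \<Rightarrow> (nat \<Rightarrow> real) \<Rightarrow> (nat \<Rightarrow> real) \<Rightarrow> bool" where
  "vagree t m v v' \<longleftrightarrow> (\<forall>j<m. v j \<le> t \<or> v' j \<le> t \<longrightarrow> v j = v' j)"

lemma vagree_sym: "vagree t m v v' \<Longrightarrow> vagree t m v' v"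
  unfolding vagree_def by metis

lemma vagreeD: "vagree t m v v' \<Longrightarrow> j < m \<Longrightarrow> v j \<le> t \<or> v' j \<le> t \<Longrightarrow> v j = v' j"
  unfolding vagree_def by blast

lemma vagree_less_iff: "vagree t m v v' \<Longrightarrow> j < m \<Longrightarrow> s \<le> t \<Longrightarrow> s < v j \<longleftrightarrow> s < v' j"
  by (smt (verit) vagreeD)

text \<open>Lateness is decided at time \<open>v i\<close> from the serial rates before it, and
  these agree up to \<open>t\<close>.\<close>

lemma late_agree:
  assumes ag: "agree t m T T'" and i: "i < m" "v i \<le> t"
    and v: "vagree t m v v'"
  shows "late p T v i \<longleftrightarrow> late p T' v' i"
proof -
  have Ti: "T ! i = T' ! i" and vi: "v i = v' i" using ag i vagreeD[OF v] by (auto simp: agree_def)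
  have "integral {arr (T ! i)..v i} (srate p T v) = integral {arr (T ! i)..v i} (srate p T' v')"
  proof (rule integral_cong_halfopen)
    fix s assume "arr (T ! i) \<le> s" "s < v i"
    then have "s \<le> t" using i by simp
    moreover have "s < v j \<longleftrightarrow> s < v' j" if "j < m" for j
      using vagree_less_iff[OF v that \<open>s \<le> t\<close>] .
    ultimately show "srate p T v s = srate p T' v' s" by (rule rate_agree[OF ag])
  qed
  then show ?thesis using Ti vi by (simp add: late_def)
qed

text \<open>A blocking job has entered the queue by time \<open>s\<close>, hence arrived before
  \<open>t\<close>. So it is one of the \<open>m\<close> common tasks, and its lateness and priority
  are the same in both instances.\<close>

lemma blocked_agree_imp:
  assumes ag: "agree t m T T'" and i: "i < m" "v i \<le> t" and s: "s \<le> t"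
    and arr: "\<forall>j<length T. arr (T ! j) < v j"
    and v: "vagree t m v v'"
    and f: "\<forall>j<m. v j \<le> t \<longrightarrow> late p T v j \<longrightarrow> (s < f j \<longleftrightarrow> s < f' j)"
    and b: "blocked p T v f i s"
  shows "blocked p T' v' f' i s"
proof -
  obtain j where j: "j < length T" "late p T v j" "prior T v j i" "v j \<le> s" "s < f j"
    using b unfolding blocked_def by blast
  have vj: "v j \<le> t" using j s by simp
  then have "arr (T ! j) < t" using arr j(1) by force
  then have jm: "j < m" using ag j(1) unfolding agree_def by (metis less_asym not_le)
  have eq: "v i = v' i" "v j = v' j" "T ! i = T' ! i" "T ! j = T' ! j"
    using vagreeD[OF v i(1)] vagreeD[OF v jm] i vj ag jm by (auto simp: agree_def)
  have "late p T' v' j" using late_agree[OF ag jm vj v] j(2) by blast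
  moreover have "j < length T'" using jm ag by (auto simp: agree_def)
  moreover have "prior T' v' j i" using j(3) by (simp add: prior_def eq)
  moreover have "s < f' j" using f jm vj j(2,5) by simp
  ultimately show ?thesis using j(4) eq unfolding blocked_def by auto
qed

lemma blocked_agree:
  assumes ag: "agree t m T T'" and i: "i < m" "v i \<le> t" and s: "s \<le> t"
    and arr: "\<forall>j<length T. arr (T ! j) < v j" "\<forall>j<length T'. arr (T' ! j) < v' j"
    and v: "vagree t m v v'"
    and f: "\<forall>j<m. v j \<le> t \<longrightarrow> late p T v j \<longrightarrow> (s < f j \<longleftrightarrow> s < f' j)"
  shows "blocked p T v f i s \<longleftrightarrow> blocked p T' v' f' i s"
proof
  assume "blocked p T v f i s"
  then show "blocked p T' v' f' i s" by (rule blocked_agree_imp[OF ag i s arr(1) v f])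
next
  assume b: "blocked p T' v' f' i s"
  have "\<forall>j<m. v' j \<le> t \<longrightarrow> late p T' v' j \<longrightarrow> (s < f' j \<longleftrightarrow> s < f j)"
    using f late_agree[OF ag _ _ v] vagreeD[OF v] by metis
  moreover have "v' i \<le> t" using vagreeD[OF v i(1)] i by simp
  ultimately show "blocked p T v f i s"
    using blocked_agree_imp[OF agree_sym[OF ag] i(1) _ s arr(2) vagree_sym[OF v] _ b] by blast
qed

lemma queue_agree:
  assumes ag: "agree t m T T'" and tap: "tap p T" "tap p T'"
    and vir: "virtual p T v" "virtual p T' v'" and q: "queue p T v f" "queue p T' v' f'"
    and i: "i < m" "v i \<le> t" "late p T v i" "f i \<le> t \<or> f' i \<le> t"
  shows "f i = f' i"
proof -
  \<comment> \<open>Only queue entries up to \<open>t\<close> are compared, since later ones may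
    differ between the instances and cannot block anything before \<open>t\<close>.\<close>
  define I where "I = {i. i < m \<and> v i \<le> t \<and> late p T v i}"
  have v: "vagree t m v v'"
    using virtual_agree[OF ag vir] by (auto simp: vagree_def)
  have vI: "v j = v' j" if "j \<in> I" for j using vagreeD[OF v] that by (auto simp: I_def)
  have arr: "\<forall>j<length T. arr (T ! j) < v j" "\<forall>j<length T'. arr (T' ! j) < v' j"
    using virtual_props(1) tap vir by blast+
  show ?thesis
  proof (rule hits_causal[where I = I and a = v and a' = v'])
    show "finite I" "i \<in> I" "f i \<le> t \<or> f' i \<le> t" using i by (simp_all add: I_def)
    show "hits I v (qdone p T v) f"
      by (rule hits_subset[OF q(1)[unfolded queue_def]]) (use ag in \<open>auto simp: agree_def I_def\<close>)
    show "hits I v' (qdone p T' v') f'"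
    proof (rule hits_subset[OF q(2)[unfolded queue_def]])
      show "I \<subseteq> {i. i < length T' \<and> late p T' v' i}"
        using late_agree[OF ag _ _ v] ag by (auto simp: I_def agree_def)
    qed
    fix i u assume i: "i \<in> I" and u: "u \<le> t" and mins: "\<And>j. j \<in> I \<Longrightarrow> min (f j) u = min (f' j) u"
    have "integral {v i..u} (free p T v f i) = integral {v i..u} (free p T' v' f' i)"
    proof (rule integral_cong_halfopen)
      fix s assume s: "v i \<le> s" "s < u"
      have "\<forall>j<m. v j \<le> t \<longrightarrow> late p T v j \<longrightarrow> (s < f j \<longleftrightarrow> s < f' j)"
      proof (intro allI impI)
        fix j assume "j < m" "v j \<le> t" "late p T v j"
        then show "s < f j \<longleftrightarrow> s < f' j"
          using mins[of j] s(2) by (auto simp: I_def min_def split: if_splits)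
      qed
      moreover have "i < m" "v i \<le> t" "s \<le> t" using i s u by (auto simp: I_def)
      ultimately have "blocked p T v f i s \<longleftrightarrow> blocked p T' v' f' i s"
        using blocked_agree[OF ag _ _ _ arr v] by blast
      then show "free p T v f i s = free p T' v' f' i s" by (simp add: free_def)
    qed
    then show "qdone p T v i f u \<longleftrightarrow> qdone p T' v' i f' u"
      using i vI[OF i] ag by (auto simp: qdone_def agree_def I_def)
  qed (rule vI)
qed

subsection \<open>Comparison with a non-cancelling schedule\<close>

text \<open>Twice the sum over pairs \<open>j \<le> i\<close> counts every off-diagonal product as
  often as the square does, and each diagonal square once more.\<close>

lemma sum_square_le_ranks:
  fixes e :: "nat \<Rightarrow> real"
  shows "(\<Sum>i<n. e i)\<^sup>2 \<le> 2 * (\<Sum>i<n. e i * (\<Sum>j\<le>i. e j))"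
proof (induction n)
  case (Suc n)
  have "(\<Sum>j\<le>n. e j) = (\<Sum>j<n. e j) + e n" by (simp add: lessThan_Suc_atMost[symmetric])
  then show ?case using Suc by (simp add: power2_eq_square algebra_simps add_increasing)
qed simp

lemma rank_le_load:
  assumes "i < length T"
  shows "(\<Sum>j\<le>i. live (arr (T ! j)) (v j) s) \<le> load T v s"
proof -
  have "(\<Sum>j\<le>i. live (arr (T ! j)) (v j) s) \<le> (\<Sum>j<length T. live (arr (T ! j)) (v j) s)"
    by (rule sum_mono2) (use assms live_bounds in auto)
  then show ?thesis using sum_live_le_load order_trans by blast
qed

lemma rank_share_integrable:
  assumes "i < length T"
  shows "(\<lambda>s. live (arr (T ! i)) (v i) s * (\<Sum>j\<le>i. live (arr (T ! j)) (v j) s) / load T v s)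
    integrable_on {x..y}" (is "?h integrable_on _")
proof (rule bounded_borel_integrable)
  show "?h \<in> borel_measurable borel" by measurable
  have "0 \<le> (\<Sum>j\<le>i. live (arr (T ! j)) (v j) s)" for s by (rule sum_nonneg) (rule live_bounds)
  then show "\<bar>?h s\<bar> \<le> 1" for s
    using rank_le_load[OF assms, of v s] load_ge_1[of T v s] by (auto simp: live_def[of "arr (T ! i)"])
qed

text \<open>With \<open>N\<close> live tasks the ranks are 1 to \<open>N\<close>, so their sum
  divided by \<open>N\<close> is at least \<open>N/2\<close>; formally,
  \<open>sum_square_le_ranks\<close> for the live indicators is divided by the load.\<close>

lemma live_rank_ge:
  "(\<Sum>i<length T. live (arr (T ! i)) (v i) s) \<le>
   2 * (\<Sum>i<length T. live (arr (T ! i)) (v i) s * (\<Sum>j\<le>i. live (arr (T ! j)) (v j) s) / load T v s)"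
  (is "?E \<le> 2 * ?S")
proof (cases "\<exists>i<length T. arr (T ! i) \<le> s \<and> s < v i")
  case True
  then have M: "load T v s = ?E" using load_eq by blast
  then have E1: "1 \<le> ?E" using load_ge_1[of T v s] by simp
  have "?E = ?E\<^sup>2 / ?E" using E1 by (simp add: power2_eq_square)
  also have "\<dots> \<le> 2 * (\<Sum>i<length T. live (arr (T ! i)) (v i) s * (\<Sum>j\<le>i. live (arr (T ! j)) (v j) s)) / ?E"
    by (rule divide_right_mono[OF sum_square_le_ranks]) (use E1 in simp)
  also have "\<dots> = 2 * ?S" unfolding M sum_divide_distrib[symmetric] by (rule times_divide_eq_right[symmetric])
  finally show ?thesis .
next
  case False
  then have "?E = 0" by (auto simp: live_def intro!: sum.neutral)
  moreover have "0 \<le> ?S"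
    using load_ge_1[of T v s] by (intro sum_nonneg divide_nonneg_nonneg mult_nonneg_nonneg live_bounds) auto
  ultimately show ?thesis by linarith
qed

lemma length_scale_tap: "length (scale_tap c T) = length T"
  by (simp add: scale_tap_def)

lemma scale_tap_nth:
  assumes "i < length T"
  shows "arr (scale_tap c T ! i) = arr (T ! i)"
    and "work (scale_tap c T ! i) b = c * work (T ! i) b"
  using assms by (auto simp: scale_tap_def arr_def work_def sw_def pw_def split: prod.split)

lemma noncancelling_props:
  assumes S: "valid_sched p T S" and i: "i < length T" and nc: "cancels S i = {}"
  shows "\<And>t. 0 \<le> alloc S i t" and "\<And>a b. alloc S i integrable_on {a..b}"
    and "\<not> impl0 S i \<Longrightarrow> alloc S i t \<le> 1"
    and "arr (T ! i) < fin S i"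
    and "integral {arr (T ! i)..fin S i} (alloc S i) = work (T ! i) (impl0 S i)"
  using S i nc by (auto simp: valid_sched_def mode_def progress_def last_start_def)

text \<open>After the optimum has finished task \<open>i\<close>, the rank of \<open>i\<close> among the live tasks is at most its
  value \<open>R\<close> at that moment, so the remaining virtual service can be charged to \<open>R\<close> times the
  work of the optimum on \<open>i\<close>. A serial task at low load runs at full speed and is charged to the
  response time of the optimum instead.\<close>

lemma rank_integral_le:
  fixes S :: sched
  assumes tap: "tap p T" and p: "1 \<le> p" and vir: "virtual p T v" and c: "1 \<le> c"
    and S: "valid_sched p (scale_tap c T) S" and nc: "cancels S i = {}" and i: "i < length T"
    and Z: "fin S i \<le> Z"
  defines "R \<equiv> (\<Sum>j\<le>i. if fin S i < v j then 1 else 0 :: real)"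
  shows "integral {0..Z} (\<lambda>s. live (arr (T ! i)) (v i) s * (\<Sum>j\<le>i. live (arr (T ! j)) (v j) s) / load T v s)
    \<le> (1 + 1 / c) * (fin S i - arr (T ! i)) +
      4 / (real p * c) * (R * integral {arr (T ! i)..fin S i} (alloc S i))"
proof -
  define a where "a = arr (T ! i)"
  define g where "g = fin S i"
  define w where "w = integral {a..g} (alloc S i)"
  define h where "h s = live a (v i) s * (\<Sum>j\<le>i. live (arr (T ! j)) (v j) s) / load T v s" for s
  note i' = i[folded length_scale_tap[of c T]]
  note opt = noncancelling_props[OF S i' nc, unfolded scale_tap_nth[OF i]]
  have ag: "a < g" and wk: "w = c * work (T ! i) (impl0 S i)" using opt by (auto simp: a_def g_def w_def)
  have a0: "0 \<le> a" using tap_nth[OF tap i] by (simp add: a_def)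
  have R0: "0 \<le> R" unfolding R_def by (rule sum_nonneg) simp
  have w0: "0 \<le> w" unfolding w_def by (rule integral_nonneg) (use opt in auto)
  note rank_load = rank_le_load[OF i, of v]
  have rank_R: "(\<Sum>j\<le>i. live (arr (T ! j)) (v j) s) \<le> R" if "g \<le> s" for s
    unfolding R_def by (rule sum_mono) (use that in \<open>auto simp: live_def g_def\<close>)
  have h_int: "h integrable_on {x..y}" for x y
    unfolding h_def a_def by (rule rank_share_integrable[OF i])
  \<comment> \<open>Charging scheme for both implementations: up to \<open>g\<close> the rank share
    is at most 1, and after \<open>g\<close> it is at most \<open>K\<close> times a rate
    \<open>r\<close> whose integral over the life span is at most \<open>W\<close>.\<close>
  have bound: "integral {0..Z} h \<le> (g - a) + K * W"
    if r_int: "\<And>x y. r integrable_on {x..y}" and r0: "\<And>x. 0 \<le> r x" and K: "0 \<le> K"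
      and rW: "integral {a..v i} r \<le> W"
      and r: "\<And>s. g \<le> s \<Longrightarrow> (\<Sum>j\<le>i. live (arr (T ! j)) (v j) s) / load T v s \<le> K * r s" for r K W
  proof -
    have "integral {0..Z} h \<le> integral {0..Z} (\<lambda>s. (if s \<in> {a..g} then 1 else 0) +
        K * (if s \<in> {a..v i} then r s else 0))"
    proof (rule integral_le)
      show "(\<lambda>s. (if s \<in> {a..g} then 1 else 0) + K * (if s \<in> {a..v i} then r s else 0)) integrable_on {0..Z}"
        by (intro integrable_add integrable_on_mult_right clip_integrable r_int integrable_const_ivl)
      fix s
      have 1: "(\<Sum>j\<le>i. live (arr (T ! j)) (v j) s) / load T v s \<le> 1"
        using rank_load[of s] load_ge_1[of T v s] by simp
      have 2: "0 \<le> K * r s" using K r0 by simp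
      show "h s \<le> (if s \<in> {a..g} then 1 else 0) + K * (if s \<in> {a..v i} then r s else 0)"
        using 1 2 r[of s] by (auto simp: h_def live_def[of a])
    qed (rule h_int)
    also have "\<dots> = integral {0..Z} (\<lambda>s. if s \<in> {a..g} then 1 else 0) +
        K * integral {0..Z} (\<lambda>s. if s \<in> {a..v i} then r s else 0)"
      by (subst integral_add) (auto intro!: integrable_on_mult_right clip_integrable r_int
          simp del: atLeastAtMost_iff)
    also have "\<dots> \<le> integral {a..g} (\<lambda>_. 1) + K * integral {a..v i} r"
      by (intro add_mono mult_left_mono integral_clip_le K r_int r0 integrable_const_ivl) auto
    also have "\<dots> \<le> (g - a) + K * W" using ag rW K by (intro add_mono mult_left_mono) auto
    finally show ?thesis .
  qed
  have "integral {0..Z} h \<le> (g - a) + ((g - a) / c + 4 / (real p * c) * (R * w))"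
  proof (cases "impl0 S i")
    case True
    \<comment> \<open>\<open>K = 4 * R / p\<close> because \<open>R\<close> divided by the load is
      exactly this multiple of \<open>prate\<close>.\<close>
    have "integral {0..Z} h \<le> (g - a) + 4 * R / real p * pw (T ! i)"
    proof (rule bound[OF prate_integrable[of p T v] prate_bounds(1)])
      show "integral {a..v i} (prate p T v) \<le> pw (T ! i)"
        unfolding a_def by (rule virtual_props(4)[OF tap vir i])
      show "(\<Sum>j\<le>i. live (arr (T ! j)) (v j) s) / load T v s \<le> 4 * R / real p * prate p T v s" if "g \<le> s" for s
        using rank_R[OF that] p load_ge_1[of T v s] by (simp add: prate_def divide_right_mono)
    qed (use R0 in simp)
    moreover have "pw (T ! i) = w / c" using wk c True by (simp add: work_def)
    moreover have "0 \<le> (g - a) / c" using ag c by simp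
    ultimately show ?thesis by (simp add: field_simps)
  next
    case False
    have sw_eq: "sw (T ! i) = w / c" using wk c False by (simp add: work_def)
    \<comment> \<open>The summand 1 of \<open>K\<close> covers loads below \<open>p / 2\<close>,
      where the serial rate is 1; the summand \<open>2 * R / p\<close> covers larger loads, where
      the rate is \<open>p\<close> over twice the load.\<close>
    have "integral {0..Z} h \<le> (g - a) + (1 + 2 * R / real p) * sw (T ! i)"
    proof (rule bound[OF srate_integrable[of p T v] srate_bounds(1)])
      show "integral {a..v i} (srate p T v) \<le> sw (T ! i)"
        unfolding a_def by (rule virtual_props(3)[OF tap vir i])
      fix s assume s: "g \<le> s"
      define M where "M = load T v s"
      define k where "k = (\<Sum>j\<le>i. live (arr (T ! j)) (v j) s)"
      have M: "1 \<le> M" "k \<le> M" "k \<le> R" using load_ge_1 rank_load rank_R[OF s] by (auto simp: M_def k_def)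
      have "k / M \<le> (1 + 2 * R / real p) * min 1 (real p / (2 * M))"
      proof (cases "real p / (2 * M) \<le> 1")
        case True
        have "k / M \<le> R / M" using M by (simp add: divide_right_mono)
        also have "\<dots> = 2 * R / real p * (real p / (2 * M))" using p by simp
        also have "\<dots> \<le> (1 + 2 * R / real p) * (real p / (2 * M))"
          using M by (intro mult_right_mono) auto
        finally show ?thesis using True by simp
      next
        case False
        have "k / M \<le> 1" using M by simp
        then show ?thesis using False R0 by (simp add: add_increasing2)
      qed
      then show "k / load T v s \<le> (1 + 2 * R / real p) * srate p T v s"
        by (simp add: M_def srate_def)
    qed (use R0 in simp)
    \<comment> \<open>The optimum also runs a serial job on at most one processor.\<close>
    moreover have "w \<le> g - a"
    proof -
      have "w \<le> integral {a..g} (\<lambda>_. 1)" unfolding w_def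
        by (rule integral_le) (use opt False in auto)
      then show ?thesis using ag by simp
    qed
    then have "w / c \<le> (g - a) / c" using c by (simp add: divide_right_mono)
    moreover have "2 * R / real p * (w / c) \<le> 4 / (real p * c) * (R * w)"
      using R0 w0 c p by (simp add: field_simps)
    moreover have "(1 + 2 * R / real p) * sw (T ! i) = w / c + 2 * R / real p * (w / c)"
      by (simp only: sw_eq distrib_right mult_1)
    ultimately show ?thesis by linarith
  qed
  then have "integral {0..Z} h \<le> (1 + 1 / c) * (g - a) + 4 / (real p * c) * (R * w)"
    by (simp add: distrib_right)
  then show ?thesis unfolding h_def[abs_def] a_def g_def w_def .
qed

text \<open>Whenever \<open>j \<le> i\<close> and \<open>j\<close> is live when the optimum finishes \<open>i\<close>, the whole execution of \<open>i\<close> by the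
  optimum lies inside the life span of \<open>j\<close>.\<close>

lemma overlap_work_le:
  assumes tap: "tap p T" and v: "\<And>j. j < length T \<Longrightarrow> arr (T ! j) \<le> v j"
    and S: "valid_sched p (scale_tap c T) S" and nc: "\<forall>i<length T. cancels S i = {}"
  shows "(\<Sum>i<length T. (\<Sum>j\<le>i. if fin S i < v j then 1 else 0) * integral {arr (T ! i)..fin S i} (alloc S i))
    \<le> real p * (\<Sum>j<length T. v j - arr (T ! j))"
proof -
  let ?n = "length T"
  have opt: "\<And>t. 0 \<le> alloc S i t" "\<And>a b. alloc S i integrable_on {a..b}" if "i < ?n" for i
    using noncancelling_props[OF S _ nc[rule_format], of i] that length_scale_tap by auto
  have srt: "arr (T ! j) \<le> arr (T ! i)" if "j \<le> i" "i < ?n" for i j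
    using tap that sorted_nth_mono[of "map arr T" j i] by (simp add: tap_def)
  have "(\<Sum>i<?n. (\<Sum>j\<le>i. if fin S i < v j then 1 else 0) * integral {arr (T ! i)..fin S i} (alloc S i))
    \<le> (\<Sum>i<?n. \<Sum>j<?n. integral {arr (T ! j)..v j} (alloc S i))"
  proof (rule sum_mono)
    fix i assume i: "i \<in> {..<?n}"
    have "(\<Sum>j\<le>i. if fin S i < v j then 1 else 0) * integral {arr (T ! i)..fin S i} (alloc S i)
      = (\<Sum>j\<le>i. if fin S i < v j then integral {arr (T ! i)..fin S i} (alloc S i) else 0)"
      unfolding sum_distrib_right by (rule sum.cong) auto
    also have "\<dots> \<le> (\<Sum>j\<le>i. integral {arr (T ! j)..v j} (alloc S i))"
    proof (rule sum_mono)
      fix j assume "j \<in> {..i}"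
      then show "(if fin S i < v j then integral {arr (T ! i)..fin S i} (alloc S i) else 0)
        \<le> integral {arr (T ! j)..v j} (alloc S i)"
        using i srt[of j i] opt[of i]
        by (auto intro!: integral_superset_mono integral_nonneg)
    qed
    also have "\<dots> \<le> (\<Sum>j<?n. integral {arr (T ! j)..v j} (alloc S i))"
      by (rule sum_mono2) (use i opt[of i] in \<open>auto intro!: integral_nonneg\<close>)
    finally show "(\<Sum>j\<le>i. if fin S i < v j then 1 else 0) * integral {arr (T ! i)..fin S i} (alloc S i)
      \<le> (\<Sum>j<?n. integral {arr (T ! j)..v j} (alloc S i))" .
  qed
  also have "\<dots> = (\<Sum>j<?n. \<Sum>i<?n. integral {arr (T ! j)..v j} (alloc S i))"
    by (rule sum.swap)
  also have "\<dots> = (\<Sum>j<?n. integral {arr (T ! j)..v j} (\<lambda>s. \<Sum>i<?n. alloc S i s))"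
    using opt by (intro sum.cong integral_sum[symmetric]) auto
  also have "\<dots> \<le> (\<Sum>j<?n. integral {arr (T ! j)..v j} (\<lambda>_. real p))"
  proof (intro sum_mono integral_le integrable_sum integrable_const_ivl)
    show "(\<Sum>i<?n. alloc S i s) \<le> real p" for s
      using S by (auto simp: valid_sched_def length_scale_tap)
  qed (use opt in auto)
  also have "\<dots> = real p * (\<Sum>j<?n. v j - arr (T ! j))"
    unfolding sum_distrib_left by (rule sum.cong) (use v in \<open>auto simp: mult.commute\<close>)
  finally show ?thesis .
qed

text \<open>With \<open>F\<close> and \<open>G\<close> the total response times of the virtual
  schedule and of \<open>S\<close>, speed \<open>c\<close> yields
  \<open>F \<le> 2 * (1 + 1/c) * G + 8/c * F\<close>, because the overlap work is itself bounded by
  \<open>p * F\<close>. The choice \<open>c = 16\<close> makes the last coefficient 1/2, so that it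
  can be absorbed.\<close>

lemma virtual_competitive:
  assumes tap: "tap p T" and p: "1 \<le> p" and vir: "virtual p T v"
    and S: "valid_sched p (scale_tap 16 T) S" and nc: "\<forall>i<length T. cancels S i = {}"
  shows "(\<Sum>i<length T. v i - arr (T ! i)) \<le> 17 / 4 * TRT (scale_tap 16 T) S"
proof -
  let ?n = "length T"
  let ?a = "\<lambda>i. arr (T ! i)"
  let ?h = "\<lambda>i s. live (?a i) (v i) s * (\<Sum>j\<le>i. live (?a j) (v j) s) / load T v s"
  define R where "R i = (\<Sum>j\<le>i. if fin S i < v j then 1 else 0 :: real)" for i
  define o' where "o' i = integral {?a i..fin S i} (alloc S i)" for i
  define F where "F = (\<Sum>i<?n. v i - ?a i)"
  define G where "G = (\<Sum>i<?n. fin S i - ?a i)"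
  \<comment> \<open>A horizon beyond all completion times of both schedules.\<close>
  define Z where "Z = (\<Sum>i<?n. \<bar>v i\<bar> + \<bar>fin S i\<bar>)"
  have Z: "v i \<le> Z" "fin S i \<le> Z" if "i < ?n" for i
    using member_le_sum[of i "{..<?n}" "\<lambda>i. \<bar>v i\<bar> + \<bar>fin S i\<bar>"] that unfolding Z_def by auto
  have av: "?a i < v i" "0 \<le> ?a i" if "i < ?n" for i
    using virtual_props(1)[OF tap vir that] tap_nth[OF tap that] by auto
  have one: "(\<lambda>s. live a b s) integrable_on {x..y}" for a b x y
    using live_mult_integrable[of "\<lambda>_. 1", OF integrable_const_ivl] by simp
  have "F = (\<Sum>i<?n. integral {0..Z} (\<lambda>s. live (?a i) (v i) s))"
    unfolding F_def
  proof (rule sum.cong)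
    fix i assume "i \<in> {..<?n}"
    then show "v i - ?a i = integral {0..Z} (\<lambda>s. live (?a i) (v i) s)"
      using integral_live[of 0 "?a i" "v i" Z "\<lambda>_. 1"] av[of i] Z[of i] by simp
  qed simp
  also have "\<dots> = integral {0..Z} (\<lambda>s. \<Sum>i<?n. live (?a i) (v i) s)"
    by (rule integral_sum[symmetric]) (auto intro: one)
  also have "\<dots> \<le> integral {0..Z} (\<lambda>s. 2 * (\<Sum>i<?n. ?h i s))"
    by (intro integral_le integrable_sum integrable_on_mult_right live_rank_ge one rank_share_integrable) auto
  also have "\<dots> = 2 * (\<Sum>i<?n. integral {0..Z} (?h i))"
    by (subst integral_mult_right, subst integral_sum) (auto intro: rank_share_integrable)
  also have "\<dots> \<le> 2 * (\<Sum>i<?n. (1 + 1 / 16) * (fin S i - ?a i) + 4 / (real p * 16) * (R i * o' i))"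
    unfolding R_def o'_def using nc Z
    by (intro mult_left_mono sum_mono rank_integral_le[OF tap p vir _ S]) auto
  also have "\<dots> = 17 / 8 * G + 1 / (2 * real p) * (\<Sum>i<?n. R i * o' i)"
    unfolding G_def sum.distrib sum_distrib_left[symmetric] by simp
  also have "\<dots> \<le> 17 / 8 * G + 1 / (2 * real p) * (real p * F)"
    unfolding R_def o'_def F_def using overlap_work_le[OF tap _ S nc, of v] av(1)
    by (intro add_left_mono mult_left_mono) (auto simp: less_imp_le)
  also have "\<dots> = 17 / 8 * G + F / 2" using p by simp
  finally have "F \<le> 17 / 4 * G" by simp
  moreover have "G = TRT (scale_tap 16 T) S"
    by (simp add: G_def TRT_def length_scale_tap scale_tap_nth)
  ultimately show ?thesis by (simp add: F_def)
qed

subsection \<open>The scheduler\<close>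

text \<open>The parallel job starts strictly after \<open>v i\<close>, because a cancellation at time \<open>v i\<close> takes effect only
  for later times.\<close>

definition two_phase_sched :: "nat \<Rightarrow> task list \<Rightarrow> (nat \<Rightarrow> real) \<Rightarrow> (nat \<Rightarrow> real) \<Rightarrow> sched" where
  "two_phase_sched p T v f =
    \<lparr>alloc = (\<lambda>i s. live (arr (T ! i)) (v i) s * srate p T v s +
        (if late p T v i \<and> v i < s \<and> s < f i then real p / 2 * free p T v f i s else 0)),
     impl0 = (\<lambda>_. False),
     cancels = (\<lambda>i. if late p T v i then {v i} else {}),
     fin = (\<lambda>i. if late p T v i then f i else v i)\<rparr>"

lemma sum_exclusive_le:
  fixes c :: real
  assumes "finite A" "0 \<le> c" and excl: "\<And>i j. i \<in> A \<Longrightarrow> j \<in> A \<Longrightarrow> P i \<Longrightarrow> P j \<Longrightarrow> i = j"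
  shows "(\<Sum>i\<in>A. if P i then c else 0) \<le> c"
proof -
  have "card {i \<in> A. P i} \<le> 1"
    using assms(1) excl by (auto simp: card_le_Suc0_iff_eq)
  then have "real (card {i \<in> A. P i}) * c \<le> 1 * c" using assms(2) by (intro mult_right_mono) auto
  then show ?thesis using assms(1) by (simp add: sum.If_cases Int_def)
qed

text \<open>The serial jobs occupy at most \<open>p / 2\<close> processors by
  \<open>sum_live_srate_le\<close>, and the queue at most the other half because it serves one job
  at a time.\<close>

lemma two_phase_valid:
  assumes tap: "tap p T" and p: "1 \<le> p" and vir: "virtual p T v" and q: "queue p T v f"
  shows "valid_sched p T (two_phase_sched p T v f)"
proof -
  define S where "S = two_phase_sched p T v f"
  have alloc: "alloc S i s = live (arr (T ! i)) (v i) s * srate p T v s +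
        (if late p T v i \<and> v i < s \<and> s < f i then real p / 2 * free p T v f i s else 0)" for i s
    by (simp add: S_def two_phase_sched_def)
  have cancels: "cancels S i = (if late p T v i then {v i} else {})" for i
    by (simp add: S_def two_phase_sched_def)
  have fin: "fin S i = (if late p T v i then f i else v i)" for i
    by (simp add: S_def two_phase_sched_def)
  have cset: "{s \<in> cancels S i. s < t} = (if late p T v i \<and> v i < t then {v i} else {})" for i t
    by (auto simp: cancels)
  have mode: "mode S i t \<longleftrightarrow> late p T v i \<and> v i < t" for i t
    unfolding mode_def cset by (simp add: S_def two_phase_sched_def)
  have cap: "(\<Sum>i<length T. alloc S i t) \<le> real p" for t
  proof -
    have "(\<Sum>i<length T. if late p T v i \<and> v i < t \<and> t < f i then real p / 2 * free p T v f i t else 0)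
      = (\<Sum>i<length T. if late p T v i \<and> v i < t \<and> t < f i \<and> \<not> blocked p T v f i t then real p / 2 else 0)"
      by (rule sum.cong) (auto simp: free_def)
    also have "\<dots> \<le> real p / 2"
    proof (rule sum_exclusive_le)
      \<comment> \<open>Of two distinct pending jobs, one has priority over the other and blocks
        it.\<close>
      fix i j assume ij: "i \<in> {..<length T}" "j \<in> {..<length T}"
        "late p T v i \<and> v i < t \<and> t < f i \<and> \<not> blocked p T v f i t"
        "late p T v j \<and> v j < t \<and> t < f j \<and> \<not> blocked p T v f j t"
      then have "\<not> prior T v i j" "\<not> prior T v j i" by (auto simp: blocked_def)
      then show "i = j" using prior_total by blast
    qed auto
    finally show ?thesis using sum_live_srate_le[of T v t p] by (simp add: alloc sum.distrib)
  qed
  have task: "(\<forall>t. alloc S i t \<ge> 0) \<and>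
        (\<forall>t. t < arr (T ! i) \<or> fin S i \<le> t \<longrightarrow> alloc S i t = 0) \<and>
        (\<forall>a b. alloc S i integrable_on {a..b}) \<and>
        (\<forall>t. \<not> mode S i t \<longrightarrow> alloc S i t \<le> 1) \<and>
        finite (cancels S i) \<and>
        (\<forall>s\<in>cancels S i. arr (T ! i) < s \<and> s < fin S i) \<and>
        arr (T ! i) < fin S i \<and>
        (\<forall>t. arr (T ! i) < t \<and> t < fin S i \<longrightarrow>
              progress T S i t < work (T ! i) (mode S i t)) \<and>
        progress T S i (fin S i) = work (T ! i) (mode S i (fin S i))" if i: "i < length T" for i
  proof -
    note V = virtual_props[OF tap vir i] and Q = queue_props[OF tap q i]
    have fin_ge: "v i \<le> fin S i" using Q(1) by (simp add: fin less_imp_le)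
    have int: "alloc S i integrable_on {a..b}" for a b
    proof -
      have "(\<lambda>s. if late p T v i \<and> v i < s \<and> s < f i then real p / 2 * free p T v f i s else 0) integrable_on {a..b}"
        by (rule bounded_borel_integrable[of _ "real p / 2"]) (measurable, auto simp: free_def)
      then show ?thesis unfolding alloc[abs_def]
        by (intro integrable_add live_mult_integrable srate_integrable)
    qed
    have prog1: "progress T S i t = integral {arr (T ! i)..t} (srate p T v)"
      if t: "t \<le> v i" for t
    proof -
      have "last_start T S i t = arr (T ! i)" using t by (simp add: last_start_def cset)
      then show ?thesis unfolding progress_def
        by (simp, intro integral_cong_halfopen) (use t in \<open>simp add: alloc live_def\<close>)
    qed
    have prog2: "progress T S i t = real p / 2 * integral {v i..t} (free p T v f i)"
      if t: "late p T v i" "v i < t" "t \<le> f i" for t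
    proof -
      have "last_start T S i t = v i" using t V(1) by (simp add: last_start_def cset)
      \<comment> \<open>Both endpoints are exempted: nothing is allocated at \<open>v i\<close>, nor
        at \<open>t\<close> when \<open>t = f i\<close>.\<close>
      moreover have "integral {v i..t} (alloc S i) = integral {v i..t} (\<lambda>s. real p / 2 * free p T v f i s)"
        by (rule integral_spike[of "{v i, t}"]) (use t in \<open>auto simp: alloc live_def\<close>)
      ultimately show ?thesis by (simp add: progress_def)
    qed
    have before: "progress T S i t < work (T ! i) (mode S i t)" if t: "arr (T ! i) < t" "t < fin S i" for t
    proof (cases "late p T v i \<and> v i < t")
      case True
      then show ?thesis using prog2[of t] Q(2)[of t] t by (simp add: mode fin work_def)
    next
      case False
      \<comment> \<open>A task that is not late ends at \<open>v i\<close>, so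
        \<open>t = v i\<close> occurs only for a late task. There the mode is still serial, and
        lateness itself says that the serial work is incomplete.\<close>
      then have "t \<le> v i" "t = v i \<Longrightarrow> late p T v i" using t by (auto simp: fin split: if_splits)
      then show ?thesis using prog1[of t] V(2)[of t] False
        by (cases "t = v i") (auto simp: mode work_def late_def)
    qed
    have at: "progress T S i (fin S i) = work (T ! i) (mode S i (fin S i))"
    proof (cases "late p T v i")
      case True
      then show ?thesis using prog2[of "f i"] Q(1,3) by (simp add: mode fin work_def)
    next
      case False
      then show ?thesis using prog1[of "v i"] V(3) by (simp add: mode fin work_def late_def)
    qed
    have "0 \<le> alloc S i t" for t
      using live_bounds srate_bounds free_bounds by (auto simp: alloc)
    moreover have "alloc S i t = 0" if "t < arr (T ! i) \<or> fin S i \<le> t" for t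
      using that V(1) fin_ge by (auto simp: alloc live_def fin split: if_splits)
    moreover have "alloc S i t \<le> 1" if "\<not> mode S i t" for t
      using that srate_bounds[of p T v t] by (auto simp: alloc live_def mode)
    moreover have "\<forall>s\<in>cancels S i. arr (T ! i) < s \<and> s < fin S i"
      using V(1) Q(1) by (auto simp: cancels fin)
    ultimately show ?thesis using int before at V(1) fin_ge by (auto simp: cancels)
  qed
  show ?thesis unfolding valid_sched_def S_def[symmetric] using cap task by blast
qed

section \<open>Choice of the completion times and the online property\<close>

definition vtime :: "nat \<Rightarrow> task list \<Rightarrow> nat \<Rightarrow> real" where
  "vtime p T = (SOME v. virtual p T v)"

text \<open>The choice may depend on the whole instance without harm, because the causality lemmas
  compare arbitrary solutions. The deadline is part of the choice so that the factor 2 on response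
  times is available later.\<close>

definition ftime :: "nat \<Rightarrow> task list \<Rightarrow> nat \<Rightarrow> real" where
  "ftime p T = (SOME f. queue p T (vtime p T) f \<and>
    (\<forall>i<length T. late p T (vtime p T) i \<longrightarrow> f i \<le> vtime p T i + (vtime p T i - arr (T ! i))))"

lemma vtime: "tap p T \<Longrightarrow> 1 \<le> p \<Longrightarrow> virtual p T (vtime p T)"
  unfolding vtime_def using someI_ex[OF virtual_exists] .

lemma ftime:
  assumes "tap p T" "1 \<le> p"
  shows "queue p T (vtime p T) (ftime p T)"
    and "i < length T \<Longrightarrow> late p T (vtime p T) i \<Longrightarrow>
      ftime p T i \<le> vtime p T i + (vtime p T i - arr (T ! i))"
  using someI_ex[OF queue_exists[OF assms vtime[OF assms]]] unfolding ftime_def by blast+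

definition two_phase :: "nat \<Rightarrow> task list \<Rightarrow> sched" where
  "two_phase p T = two_phase_sched p T (vtime p T) (ftime p T)"

lemma two_phase_agree:
  assumes ag: "agree t m T T'" and tap: "tap p T" "tap p T'" and p: "1 \<le> p" and i: "i < m"
  shows "\<forall>s\<le>t. alloc (two_phase p T) i s = alloc (two_phase p T') i s"
    and "{s \<in> cancels (two_phase p T) i. s \<le> t} = {s \<in> cancels (two_phase p T') i. s \<le> t}"
proof -
  define v v' f f' where "v = vtime p T" "v' = vtime p T'" "f = ftime p T" "f' = ftime p T'"
  note defs = this
  have vir: "virtual p T v" "virtual p T' v'" and q: "queue p T v f" "queue p T' v' f'"
    using vtime ftime(1) tap p by (auto simp: defs)
  have va: "vagree t m v v'"
    unfolding vagree_def using virtual_agree[OF ag vir] by blast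
  have arr: "\<forall>j<length T. arr (T ! j) < v j" "\<forall>j<length T'. arr (T' ! j) < v' j"
    using virtual_props(1) tap vir by blast+
  have Ti: "T ! i = T' ! i" using ag i by (simp add: agree_def)
  have late: "late p T v i \<longleftrightarrow> late p T' v' i" if "v i \<le> t" using late_agree[OF ag i that va] .
  have fi: "s < f j \<longleftrightarrow> s < f' j" if "s \<le> t" "j < m" "v j \<le> t" "late p T v j" for s j
    using queue_agree[OF ag tap vir q that(2-4)] that(1) by (smt (verit))
  show "\<forall>s\<le>t. alloc (two_phase p T) i s = alloc (two_phase p T') i s"
  proof (intro allI impI)
    fix s assume s: "s \<le> t"
    have iff: "s < v j \<longleftrightarrow> s < v' j" if "j < m" for j using vagree_less_iff[OF va that s] .
    have rate: "srate p T v s = srate p T' v' s" by (rule rate_agree[OF ag s iff])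
    have live: "live (arr (T ! i)) (v i) s = live (arr (T' ! i)) (v' i) s"
      using iff[OF i] by (simp add: live_def Ti)
    have par: "(if late p T v i \<and> v i < s \<and> s < f i then real p / 2 * free p T v f i s else 0) =
      (if late p T' v' i \<and> v' i < s \<and> s < f' i then real p / 2 * free p T' v' f' i s else 0)"
    proof (cases "v i \<le> t")
      case True
      have "v i = v' i" using vagreeD[OF va i] True by simp
      moreover have "free p T v f i s = free p T' v' f' i s"
        using blocked_agree[OF ag i True s arr va, of p f f'] fi[OF s] by (auto simp: free_def)
      ultimately show ?thesis using late[OF True] fi[OF s i True] by auto
    next
      case False
      \<comment> \<open>Both tasks are still in their serial phase at every time up to
        \<open>t\<close>, so neither queue term is active.\<close>
      then have "\<not> v' i \<le> t" using vagreeD[OF va i] by auto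
      then show ?thesis using False s by auto
    qed
    show "alloc (two_phase p T) i s = alloc (two_phase p T') i s"
      unfolding two_phase_def two_phase_sched_def defs[symmetric] sched.select_convs rate live par ..
  qed
  show "{s \<in> cancels (two_phase p T) i. s \<le> t} = {s \<in> cancels (two_phase p T') i. s \<le> t}"
    unfolding two_phase_def two_phase_sched_def defs[symmetric] sched.select_convs
  proof (cases "v i \<le> t")
    case True
    then show "{s \<in> if late p T v i then {v i} else {}. s \<le> t} = {s \<in> if late p T' v' i then {v' i} else {}. s \<le> t}"
      using late vagreeD[OF va i] by auto
  next
    case False
    then have "\<not> v' i \<le> t" using vagreeD[OF va i] by auto
    then show "{s \<in> if late p T v i then {v i} else {}. s \<le> t} = {s \<in> if late p T' v' i then {v' i} else {}. s \<le> t}"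
      using False by auto
  qed
qed

lemma agreeI:
  assumes eq: "take k T = take k T'"
    and T: "\<forall>\<tau>\<in>set (drop k T). t < arr \<tau>" and T': "\<forall>\<tau>\<in>set (drop k T'). t < arr \<tau>"
  shows "agree t (length (take k T)) T T'"
proof -
  define m where "m = length (take k T)"
  have m: "m = min (length T) k" "m = min (length T') k"
    using arg_cong[OF eq, of length] by (simp_all add: m_def)
  have dr: "t < arr (U ! i)" if "\<forall>\<tau>\<in>set (drop k U). t < arr \<tau>" "m = min (length U) k" "m \<le> i" "i < length U" for U i
  proof -
    have "U ! i = drop k U ! (i - k)" "i - k < length (drop k U)" using that by auto
    then show ?thesis using that(1) nth_mem by metis
  qed
  have "T ! i = T' ! i" if "i < m" for i
    using that m arg_cong[OF eq, of "\<lambda>xs. xs ! i"] by simp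
  then show ?thesis unfolding agree_def m_def[symmetric] using m dr[OF T] dr[OF T'] by auto
qed

lemma two_phase_online:
  assumes "1 \<le> p"
  shows "online_cancelling_scheduler p (two_phase p)"
  unfolding online_cancelling_scheduler_def
proof (intro conjI allI impI)
  show "valid_sched p T (two_phase p T)" if "tap p T" for T
    unfolding two_phase_def by (intro two_phase_valid that assms vtime ftime(1))
next
  fix T T' k t i s
  assume *: "tap p T" "tap p T'" "take k T = take k T'"
    "\<forall>\<tau>\<in>set (drop k T). t < arr \<tau>" "\<forall>\<tau>\<in>set (drop k T'). t < arr \<tau>" "i < length (take k T)"
  note ag = two_phase_agree[OF agreeI[OF *(3-5)] *(1,2) assms *(6)]
  show "alloc (two_phase p T) i s = alloc (two_phase p T') i s" if "s \<le> t" using ag(1) that by blast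
  show "{s \<in> cancels (two_phase p T) i. s \<le> t} = {s \<in> cancels (two_phase p T') i. s \<le> t}" by (rule ag(2))
  show "impl0 (two_phase p T) i = impl0 (two_phase p T') i"
    by (simp add: two_phase_def two_phase_sched_def)
qed

section \<open>Scaled instances and the bound against the optimum\<close>

lemma tap_scale:
  assumes "tap p T" "0 < c"
  shows "tap p (scale_tap c T)"
proof -
  have "map arr (scale_tap c T) = map arr T"
    by (simp add: scale_tap_def arr_def split: prod.split)
  moreover have "0 \<le> arr \<tau> \<and> 0 < sw \<tau> \<and> sw \<tau> \<le> pw \<tau> \<and> pw \<tau> \<le> real p * sw \<tau>"
    if "\<tau> \<in> set (scale_tap c T)" for \<tau>
  proof -
    obtain s q a where *: "(s, q, a) \<in> set T" "\<tau> = (c * s, c * q, a)"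
      using \<open>\<tau> \<in> set (scale_tap c T)\<close> by (auto simp: scale_tap_def)
    then have "0 \<le> a" "0 < s" "s \<le> q" "q \<le> real p * s"
      using assms(1) by (fastforce simp: tap_def arr_def sw_def pw_def)+
    then show ?thesis using *(2) assms(2) mult_left_mono[of q "real p * s" c]
      by (simp add: arr_def sw_def pw_def mult.left_commute)
  qed
  ultimately show ?thesis using assms(1) by (simp add: tap_def)
qed

text \<open>\<open>TRT_OPT\<close> is an infimum of reals, which can be bounded below through its
  members only if there are any.\<close>

lemma noncancelling_exists:
  assumes tap: "tap p T" and p: "1 \<le> p"
  shows "\<exists>S. valid_sched p T S \<and> (\<forall>i<length T. cancels S i = {})"
proof -
  \<comment> \<open>Every serial job runs at constant rate \<open>1 / n\<close>, so at most one
    processor is used in total. For the empty instance \<open>1 / n\<close> is 0.\<close>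
  define n where "n = real (length T)"
  define g where "g i = arr (T ! i) + n * sw (T ! i)" for i
  define S where "S = \<lparr>alloc = (\<lambda>i s. live (arr (T ! i)) (g i) s * (1 / n)),
    impl0 = (\<lambda>_. False), cancels = (\<lambda>_. {}), fin = g\<rparr>"
  have fields: "alloc S i = (\<lambda>s. live (arr (T ! i)) (g i) s * (1 / n))" "cancels S i = {}" "fin S i = g i" for i
    by (simp_all add: S_def)
  have mode: "\<not> mode S i t" for i t by (simp add: mode_def S_def)
  have cap: "(\<Sum>i<length T. alloc S i t) \<le> real p" for t
  proof -
    have "(\<Sum>i<length T. alloc S i t) \<le> (\<Sum>i<length T. 1 / n)"
      by (rule sum_mono) (auto simp: fields live_def n_def)
    also have "\<dots> \<le> 1" by (simp add: n_def)
    finally show ?thesis using p by simp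
  qed
  have prog: "progress T S i t = (t - arr (T ! i)) / n" if "arr (T ! i) < t" "t \<le> g i" for i t
  proof -
    have "last_start T S i t = arr (T ! i)" by (simp add: last_start_def fields)
    moreover have "integral {arr (T ! i)..t} (alloc S i) = integral {arr (T ! i)..t} (\<lambda>s. 1 / n)"
      by (rule integral_cong_halfopen) (use that in \<open>simp add: fields live_def\<close>)
    ultimately show ?thesis using that by (simp add: progress_def)
  qed
  have pos: "arr (T ! i) < g i" "1 \<le> n" if "i < length T" for i
    using tap_nth[OF tap that] that by (auto simp: g_def n_def intro!: mult_pos_pos)
  have "valid_sched p T S"
    unfolding valid_sched_def
  proof (intro conjI allI impI)
    fix i t assume i: "i < length T"
    show "0 \<le> alloc S i t" by (simp add: fields live_def n_def)
    show "alloc S i t = 0" if "t < arr (T ! i) \<or> fin S i \<le> t"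
      using that by (auto simp: fields live_def)
    show "alloc S i integrable_on {a..b}" for a b
      unfolding fields by (rule live_mult_integrable) (rule integrable_const_ivl)
    show "alloc S i t \<le> 1" using pos[OF i] by (simp add: fields live_def)
    show "progress T S i t < work (T ! i) (mode S i t)" if "arr (T ! i) < t \<and> t < fin S i"
      using prog[of i t] pos[OF i] that by (auto simp: fields work_def mode g_def pos_divide_less_eq mult.commute)
    show "progress T S i (fin S i) = work (T ! i) (mode S i (fin S i))"
      using prog[of i "g i"] pos[OF i] by (simp add: fields work_def mode g_def)
  qed (use cap pos in \<open>auto simp: fields\<close>)
  then show ?thesis using fields(2) by blast
qed

text \<open>The queue at most doubles each virtual response time, so the constant is twice the 17/4
  of \<open>virtual_competitive\<close>.\<close>

lemma two_phase_competitive: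
  assumes tap: "tap p T" and p: "1 \<le> p"
  shows "TRT T (two_phase p T) \<le> 17 / 2 * TRT_OPT p (scale_tap 16 T)"
proof -
  define v where "v = vtime p T"
  let ?X = "{TRT (scale_tap 16 T) S | S. valid_sched p (scale_tap 16 T) S \<and>
    (\<forall>i<length (scale_tap 16 T). cancels S i = {})}"
  have vir: "virtual p T v" unfolding v_def by (rule vtime[OF tap p])
  have "TRT T (two_phase p T) \<le> (\<Sum>i<length T. 2 * (v i - arr (T ! i)))"
    unfolding TRT_def
  proof (rule sum_mono)
    fix i assume "i \<in> {..<length T}"
    then show "fin (two_phase p T) i - arr (T ! i) \<le> 2 * (v i - arr (T ! i))"
      using ftime(2)[OF tap p, of i] virtual_props(1)[OF tap vir, of i]
      by (auto simp: two_phase_def two_phase_sched_def v_def)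
  qed
  also have "\<dots> = 2 * (\<Sum>i<length T. v i - arr (T ! i))" by (rule sum_distrib_left[symmetric])
  finally have le: "TRT T (two_phase p T) \<le> 2 * (\<Sum>i<length T. v i - arr (T ! i))" .
  \<comment> \<open>The constant is moved to the left so that the claim becomes a lower bound on
    every member of \<open>?X\<close>.\<close>
  have "2 / 17 * TRT T (two_phase p T) \<le> Inf ?X"
  proof (rule cInf_greatest)
    show "?X \<noteq> {}" using noncancelling_exists[OF tap_scale[OF tap] p, of 16] by auto
    fix x assume "x \<in> ?X"
    then obtain S where S: "x = TRT (scale_tap 16 T) S" "valid_sched p (scale_tap 16 T) S"
      "\<forall>i<length T. cancels S i = {}" by (auto simp: length_scale_tap)
    show "2 / 17 * TRT T (two_phase p T) \<le> x"
      using le virtual_competitive[OF tap p vir S(2,3)] S(1) by simp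
  qed
  then show ?thesis by (simp add: TRT_OPT_def)
qed

theorem theorem6p3:
  shows "\<exists>(c::real) (C::real) (p0::nat). c \<ge> 1 \<and> C \<ge> 1 \<and>
    (\<forall>p\<ge>p0. \<exists>ALG. online_cancelling_scheduler p ALG \<and>
       (\<forall>T. tap p T \<longrightarrow> TRT T (ALG T) \<le> C * TRT_OPT p (scale_tap c T)))"
proof (intro exI conjI allI impI)
  \<comment> \<open>The witnesses, found by unification, are speed \<open>c = 16\<close>, ratio
    \<open>C = 17 / 2\<close> and \<open>p0 = 1\<close>.\<close>
  fix p :: nat assume p: "p \<ge> 1"
  show "online_cancelling_scheduler p (two_phase p)" by (rule two_phase_online[OF p])
  show "TRT T (two_phase p T) \<le> 17 / 2 * TRT_OPT p (scale_tap 16 T)" if "tap p T" for T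
    by (rule two_phase_competitive[OF that p])
qed auto

end
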